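(* Let $\mathcal{R}=(0,\infty)$, let $\eta$ be a measure on $\mathcal{R}$ and $\rho(dz\mid u)$ a kernel of measures on $\mathcal{R}$ such that $\int_B\int_{\mathcal{R}}\min(z,1)\,\rho(dz\mid u)\,\eta(du)<\infty$ for every bounded set $B\subset\mathcal{R}$. Let $\mu$ be a completely random measure on $\mathcal{R}$ without drift whose law is given by the Laplace functional $$\mathbb{E}\big[e^{-\int g\,d\mu}\big]=\exp\Big[-\int_{\mathcal{R}}\int_{\mathcal{R}}\big(1-e^{-g(u)z}\big)\rho(dz\mid u)\,\eta(du)\Big]$$ for nonnegative $g$, and consider the decreasing hazard rate $\lambda(t\mid\mu)=\int_{\mathcal{R}}\mathbb{I}(t<u)\,\mu(du)$. Suppose $N$ items are observed until time $\tau$, giving data $\mathbf{T}=(T_1,\dots,T_N)$ with completely observed failure times $T_1<\dots<T_n<\tau$ and right-censored times $T_{n+1}=\dots=T_N=\tau$, and that the likelihood of the data given $\mu$ is $$\frac{N!}{(N-n)!}\Big[\prod_{i=1}^n\int_{\mathcal{R}}\mathbb{I}(T_i<u_i)\,\mu(du_i)\Big]\exp\Big[-\int_{\mathcal{R}}g_N(u)\,\mu(du)\Big],\qquad g_N(u)=\int_0^\tau\Big[\sum_{i=1}^N\mathbb{I}(T_i\ge t)\Big]\mathbb{I}(t<u)\,dt .$$ Assume that $\kappa_i(u):=\int_{\mathcal{R}}z^i e^{-g_N(u)z}\rho(dz\mid u)<\infty$ for every integer $1\le i\le n$ and every fixed $u>0$. Then the posterior law of $\mu$ given $\mathbf{T}$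 is the law of the random measure produced by the following three-step experiment: (i) Draw an $\mathbf{S}$-path $\mathbf{S}=(0,S_1,\dots,S_{n-1},n)$ with probability $Z(\mathbf{S})=\phi(\mathbf{S})/\sum_{\mathbf{S}'}\phi(\mathbf{S}')$ (the sum over all $\mathbf{S}$-paths with $n+1$ coordinates), where, with $m_j=S_j-S_{j-1}$, $$\phi(\mathbf{S})=\prod_{j\in\{1,\dots,n\}:\,m_j>0}\binom{j-1-S_{j-1}}{j-S_j}\int_{T_j}^{\infty}\kappa_{m_j}(y)\,\eta(dy).$$ (ii) Given $\mathbf{S}$, draw independent pairs $(y_j,Q_j)$, one for each $j\in\{1,\dots,n\}$ with $m_j>0$, where $y_j$ has distribution $\eta_j(dy_j\mid\mathbf{S},\mathbf{T})\propto\mathbb{I}(T_j<y_j)\,\kappa_{m_j}(y_j)\,\eta(dy_j)$, and, given $y_j$, $Q_j$ has distribution $\Pr\{Q_j\in dz\mid\mathbf{S},y_j,\mathbf{T}\}\propto z^{m_j}e^{-g_N(y_j)z}\rho(dz\mid y_j)$. (iii) Given $(\mathbf{S},(y_j,Q_j)_{j:m_j>0})$, set $\mu=\mu_N^*+\sum_{j:\,m_j>0}Q_j\delta_{y_j}$, where $\mu_N^*$ is an independent completely random measure (without drift) with intensity measure $e^{-g_N(u)z}\rho(dz\mid u)\,\eta(du)$.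
   Context: An $\mathbf{S}$-path with $n+1$ coordinates is an integer vector $\mathbf{S}=(S_0,S_1,\dots,S_n)$ with $S_0=0$, $S_n=n$, $S_j\le j$ for $j=1,\dots,n-1$, and $S_j\le S_{j+1}$ for $j=1,\dots,n-1$. Its increments are $m_j=S_j-S_{j-1}$, $j=1,\dots,n$. A completely random measure with intensity measure $\nu(dz,du)$ is the random measure $\int z\,\mathcal{N}(dz,du)$ where $\mathcal{N}$ is a Poisson random measure on $\mathcal{R}\times\mathcal{R}$ with mean measure $\nu$. $\delta_y$ denotes the Dirac measure at $y$ and $\mathbb{I}$ the indicator function.
   Formalization: S-paths are required to have nonnegative entries (the stated definition allows negative S_1, giving infinitely many paths and a possibly divergent normalizer); the marginal likelihood is assumed positive and finite, and failure times positive. *)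

theory Defs
  imports "HOL-Probability.Probability"
begin

definition meas_space :: "real measure measure" where
  "meas_space = sigma {M. sets M = sets borel}
     {(\<lambda>M. emeasure M B) -` A \<inter> {M. sets M = sets borel} | B A.
        B \<in> sets borel \<and> A \<in> sets (borel :: ennreal measure)}"

definition enn_exp_neg :: "ennreal \<Rightarrow> ennreal" where
  "enn_exp_neg x = (if x = \<top> then 0 else ennreal (exp (- enn2real x)))"

definition is_crm_law ::
  "real measure measure \<Rightarrow> (real \<Rightarrow> real measure) \<Rightarrow> real measure \<Rightarrow> bool" where
  "is_crm_law L \<rho> \<eta> \<longleftrightarrow> prob_space L \<and> sets L = sets meas_space \<and>
     (\<forall>g \<in> borel_measurable borel. (\<forall>u. 0 \<le> g u) \<longrightarrow>
        (\<integral>\<^sup>+ M. enn_exp_neg (\<integral>\<^sup>+ u. ennreal (g u) \<partial>M) \<partial>L)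
        = enn_exp_neg (\<integral>\<^sup>+ u. (\<integral>\<^sup>+ z. ennreal (1 - exp (- g u * z)) \<partial>\<rho> u) \<partial>\<eta>))"

text \<open>S-paths with n+1 coordinates, S = (S_0,...,S_n) with natural-number
entries, stored as a function nat => nat that vanishes beyond n.\<close>
definition is_Spath :: "nat \<Rightarrow> (nat \<Rightarrow> nat) \<Rightarrow> bool" where
  "is_Spath n S \<longleftrightarrow> S 0 = 0 \<and> S n = n \<and> (\<forall>j\<in>{1..n-1}. S j \<le> j)
     \<and> (\<forall>j\<in>{1..n-1}. S j \<le> S (j+1)) \<and> (\<forall>j>n. S j = 0)"

definition Spaths :: "nat \<Rightarrow> (nat \<Rightarrow> nat) set" where
  "Spaths n = {S. is_Spath n S}"

definition incr :: "(nat \<Rightarrow> nat) \<Rightarrow> nat \<Rightarrow> nat" where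
  "incr S j = S j - S (j - 1)"

definition jumps :: "nat \<Rightarrow> (nat \<Rightarrow> nat) \<Rightarrow> nat set" where
  "jumps n S = {j \<in> {1..n}. incr S j > 0}"

definition gN :: "nat \<Rightarrow> (nat \<Rightarrow> real) \<Rightarrow> real \<Rightarrow> real \<Rightarrow> real" where
  "gN N T \<tau> u = (LINT t:{0..\<tau>}|lborel.
      (\<Sum>i=1..N. if T i \<ge> t then 1 else 0) * indicator {..<u} t)"

definition kappa :: "(real \<Rightarrow> real) \<Rightarrow> (real \<Rightarrow> real measure) \<Rightarrow> nat \<Rightarrow> real \<Rightarrow> ennreal" where
  "kappa g \<rho> i u = (\<integral>\<^sup>+ z. ennreal (z ^ i * exp (- g u * z)) \<partial>\<rho> u)"

definition phi :: "nat \<Rightarrow> (nat \<Rightarrow> real) \<Rightarrow> (real \<Rightarrow> real) \<Rightarrow> (real \<Rightarrow> real measure)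
    \<Rightarrow> real measure \<Rightarrow> (nat \<Rightarrow> nat) \<Rightarrow> ennreal" where
  "phi n T g \<rho> \<eta> S = (\<Prod>j\<in>jumps n S.
      of_nat ((j - 1 - S (j - 1)) choose (j - S j))
      * (\<integral>\<^sup>+ y \<in> {T j<..}. kappa g \<rho> (incr S j) y \<partial>\<eta>))"

definition Zprob :: "nat \<Rightarrow> (nat \<Rightarrow> real) \<Rightarrow> (real \<Rightarrow> real) \<Rightarrow> (real \<Rightarrow> real measure)
    \<Rightarrow> real measure \<Rightarrow> (nat \<Rightarrow> nat) \<Rightarrow> ennreal" where
  "Zprob n T g \<rho> \<eta> S = phi n T g \<rho> \<eta> S / (\<Sum>S'\<in>Spaths n. phi n T g \<rho> \<eta> S')"

text \<open>Joint law of (y_j, Q_j) given S: y_j ~ eta_j(dy) proportional to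
I(T_j < y) kappa_{m_j}(y) eta(dy), and given y_j, Q_j ~ z^{m_j} e^{-g_N(y_j) z}
rho(dz|y_j) / kappa_{m_j}(y_j).  Evaluated on a set A of pairs (y,z).\<close>
definition pair_law :: "nat \<Rightarrow> (nat \<Rightarrow> real) \<Rightarrow> (real \<Rightarrow> real) \<Rightarrow> (real \<Rightarrow> real measure)
    \<Rightarrow> real measure \<Rightarrow> (nat \<Rightarrow> nat) \<Rightarrow> nat \<Rightarrow> (real \<times> real) set \<Rightarrow> ennreal" where
  "pair_law n T g \<rho> \<eta> S j A =
     (let m = incr S j;
          c = (\<integral>\<^sup>+ y. indicator {T j<..} y * kappa g \<rho> m y \<partial>\<eta>)
      in \<integral>\<^sup>+ y. (indicator {T j<..} y * kappa g \<rho> m y / c) *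
            (\<integral>\<^sup>+ z. indicator A (y, z) * ennreal (z ^ m * exp (- g y * z)) / kappa g \<rho> m y
               \<partial>\<rho> y) \<partial>\<eta>)"

definition add_atoms :: "real measure \<Rightarrow> nat set \<Rightarrow> (nat \<Rightarrow> real) \<Rightarrow> (nat \<Rightarrow> real) \<Rightarrow> real measure" where
  "add_atoms M J y Q = measure_of UNIV (sets borel)
     (\<lambda>A. emeasure M A + (\<Sum>j\<in>J. ennreal (Q j) * indicator A (y j)))"

definition likelihood :: "nat \<Rightarrow> nat \<Rightarrow> (nat \<Rightarrow> real) \<Rightarrow> real \<Rightarrow> real measure \<Rightarrow> ennreal" where
  "likelihood N n T \<tau> M =
     ennreal (fact N / fact (N - n)) * (\<Prod>i\<in>{1..n}. emeasure M {T i<..})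
     * enn_exp_neg (\<integral>\<^sup>+ u. ennreal (gN N T \<tau> u) \<partial>M)"

definition posterior :: "real measure measure \<Rightarrow> (real measure \<Rightarrow> ennreal) \<Rightarrow> real measure measure" where
  "posterior L lik = density L (\<lambda>M. lik M / (\<integral>\<^sup>+ M'. lik M' \<partial>L))"

end

theory Submission
  imports Defs
begin

text \<open>The law of a random measure is determined by its Laplace functional, so it suffices to
  compare \<open>E exp (- \<mu>(f))\<close> under both laws. With \<open>h = g\<^sub>N + f\<close>, differentiating the Laplace functional
  in the directions \<open>1\<^bsub>(T\<^sub>i, \<infinity>)\<^esub>\<close> gives the Palm formula for products
  \<open>\<Prod>\<^sub>i (\<mu>(T\<^sub>i, \<infinity>) + x)\<close>. A jump \<open>(y, z)\<close> with \<open>y > T\<^sub>n\<close> lies in all the sets \<open>(T\<^sub>i, \<infinity>)\<close>, \<open>i < n\<close>,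
  hence only shifts \<open>x\<close> to \<open>x + z\<close>; expanding \<open>(x + z)\<^sup>k\<close> yields
  a recursion in \<open>n\<close> solved by the sum over S-paths, where \<open>x = 0\<close> selects the complete paths. The normalised
  sum, divided by its value at \<open>f = 0\<close>, is the Laplace functional of the three-step
  experiment.\<close>

section \<open>Laplace functionals\<close>

text \<open>The mass \<open>emeasure M B\<close> may be infinite, and its mean may be infinite even
  if it is almost surely finite, since the Levy condition controls only min(z, 1). Test functions
  are therefore finite and nonnegative, so that infinite mass merely gives a factor 0, and
  derivatives are replaced by the quotients (1 - exp(-t x))/t with t = 2^{-k}. These increase to x,
  so monotone convergence replaces differentiation under the integral. Identities stay additive
  until a summand known to be finite can be cancelled. For product moments the finiteness comes from
  the exposure: some item is at risk up to T_1, hence g_N >= T_1 on (T_1, \<infinity>), and exp(-T_1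
  x) beats every polynomial in x. The splitting psi(g_N + f) = psi(g_N) + Delta(f) is exponential
  tilting: Delta is the Laplace exponent of the random measure with the tilted intensity, and
  exp(-psi(g_N)) drops out on normalisation. An increment m_j > 0 records one jump beyond T_j shared
  by m_j of the observed failures, T_j being the latest of their times.\<close>

lemma enn_exp_neg_ennreal: "0 \<le> x \<Longrightarrow> enn_exp_neg (ennreal x) = ennreal (exp (- x))"
  by (simp add: enn_exp_neg_def)

lemma enn_exp_neg_0 [simp]: "enn_exp_neg 0 = 1"
  by (simp add: enn_exp_neg_def)

lemma enn_exp_neg_top [simp]: "enn_exp_neg \<top> = 0"
  by (simp add: enn_exp_neg_def)

lemma enn_exp_neg_add: "enn_exp_neg (x + y) = enn_exp_neg x * enn_exp_neg y"
  by (cases x; cases y)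
     (simp_all add: enn_exp_neg_ennreal mult_exp_exp flip: ennreal_plus ennreal_mult)

lemma enn_exp_neg_mult_of_nat: "enn_exp_neg (of_nat k * x) = enn_exp_neg x ^ k"
  by (induction k) (simp_all add: distrib_right enn_exp_neg_add)

lemma enn_exp_neg_sum: "enn_exp_neg (\<Sum>i\<in>I. f i) = (\<Prod>i\<in>I. enn_exp_neg (f i))"
  by (induction I rule: infinite_finite_induct) (simp_all add: enn_exp_neg_add)

lemma enn_exp_neg_le_1: "enn_exp_neg x \<le> 1"
  by (cases x) (simp_all add: enn_exp_neg_ennreal ennreal_le_1)

lemma enn_exp_neg_less_top [simp]: "enn_exp_neg x < \<top>"
  using enn_exp_neg_le_1[of x] by (rule le_less_trans) simp

lemma enn_exp_neg_ne_top [simp]: "enn_exp_neg x \<noteq> \<top>"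
  using enn_exp_neg_less_top[of x] by (simp add: less_top)

lemma enn_exp_neg_antimono: "x \<le> y \<Longrightarrow> enn_exp_neg y \<le> enn_exp_neg x"
  by (cases x; cases y) (auto simp: enn_exp_neg_ennreal top_unique)

lemma measurable_enn_exp_neg [measurable]: "enn_exp_neg \<in> borel_measurable borel"
  unfolding enn_exp_neg_def[abs_def] by measurable

section \<open>The sigma-algebra on the space of measures\<close>

lemma space_meas_space: "space meas_space = {M. sets M = sets borel}"
  unfolding meas_space_def by (rule space_measure_of) auto

lemma sets_meas_space: "sets meas_space = sigma_sets {M. sets M = sets borel}
     {(\<lambda>M. emeasure M B) -` A \<inter> {M. sets M = sets borel} | B A.
        B \<in> sets borel \<and> A \<in> sets (borel :: ennreal measure)}"
  unfolding meas_space_def by (rule sets_measure_of) auto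

lemma measurable_emeasure_meas_space [measurable]:
  assumes "B \<in> sets borel"
  shows "(\<lambda>M. emeasure M B) \<in> borel_measurable meas_space"
proof (rule measurableI)
  fix A :: "ennreal set" assume "A \<in> sets borel"
  then show "(\<lambda>M. emeasure M B) -` A \<inter> space meas_space \<in> sets meas_space"
    unfolding space_meas_space sets_meas_space using assms by (intro sigma_sets.Basic) auto
qed simp

lemma measurable_meas_spaceI:
  fixes f :: "'a \<Rightarrow> real measure"
  assumes "\<And>x. x \<in> space N \<Longrightarrow> sets (f x) = sets borel"
    and "\<And>B. B \<in> sets borel \<Longrightarrow> (\<lambda>x. emeasure (f x) B) \<in> borel_measurable N"
  shows "f \<in> measurable N meas_space"
  unfolding meas_space_def
proof (rule measurable_measure_of)
  show "f \<in> space N \<rightarrow> {M. sets M = sets borel}" using assms(1) by auto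
  fix X :: "real measure set" assume "X \<in> {(\<lambda>M. emeasure M B) -` A \<inter> {M. sets M = sets borel} | B A.
        B \<in> sets borel \<and> A \<in> sets (borel :: ennreal measure)}"
  then obtain B A where X: "X = (\<lambda>M. emeasure M B) -` A \<inter> {M. sets M = sets borel}"
    "B \<in> sets borel" "A \<in> sets (borel :: ennreal measure)" by auto
  have "f -` X \<inter> space N = (\<lambda>x. emeasure (f x) B) -` A \<inter> space N"
    using assms(1) X(1) by auto
  then show "f -` X \<inter> space N \<in> sets N"
    using measurable_sets[OF assms(2)[OF X(2)] X(3)] by simp
qed auto

lemma measurable_nn_integral_meas_space [measurable]:
  assumes "f \<in> borel_measurable borel"
  shows "(\<lambda>M. \<integral>\<^sup>+u. f u \<partial>M) \<in> borel_measurable meas_space"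
  using assms
proof (induction rule: borel_measurable_induct)
  case (cong f g)
  then have "f = g" by (auto simp: space_borel)
  with cong show ?case by simp
next
  case (set A)
  have "(\<lambda>M. \<integral>\<^sup>+u. indicator A u \<partial>M) \<in> borel_measurable meas_space
    \<longleftrightarrow> (\<lambda>M. emeasure M A) \<in> borel_measurable meas_space"
    using set by (intro measurable_cong) (simp add: space_meas_space nn_integral_indicator)
  with set show ?case by simp
next
  case (mult u c)
  have "(\<lambda>M. \<integral>\<^sup>+x. c * u x \<partial>M) \<in> borel_measurable meas_space
    \<longleftrightarrow> (\<lambda>M. c * (\<integral>\<^sup>+x. u x \<partial>M)) \<in> borel_measurable meas_space"
    using mult by (intro measurable_cong nn_integral_cmult)
      (simp add: space_meas_space cong: measurable_cong_sets)
  with mult show ?case by simp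
next
  case (add u v)
  have "(\<lambda>M. \<integral>\<^sup>+x. v x + u x \<partial>M) \<in> borel_measurable meas_space
    \<longleftrightarrow> (\<lambda>M. (\<integral>\<^sup>+x. v x \<partial>M) + (\<integral>\<^sup>+x. u x \<partial>M)) \<in> borel_measurable meas_space"
    using add by (intro measurable_cong nn_integral_add)
      (simp_all add: space_meas_space cong: measurable_cong_sets)
  with add show ?case by simp
next
  case (seq U)
  have "(\<lambda>M. \<integral>\<^sup>+x. (SUP i. U i) x \<partial>M) \<in> borel_measurable meas_space
    \<longleftrightarrow> (\<lambda>M. SUP i. \<integral>\<^sup>+x. U i x \<partial>M) \<in> borel_measurable meas_space"
    unfolding SUP_apply using seq by (intro measurable_cong nn_integral_monotone_convergence_SUP)
      (simp_all add: space_meas_space cong: measurable_cong_sets)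
  with seq show ?case by simp
qed

section \<open>The moment problem on the unit interval\<close>

lemma weierstrass_polynomial:
  fixes f :: "real \<Rightarrow> real"
  assumes "continuous_on {0..1} f" "0 < e"
  obtains a :: "nat \<Rightarrow> real" and m where "\<And>x. x \<in> {0..1} \<Longrightarrow> \<bar>f x - (\<Sum>i\<le>m. a i * x ^ i)\<bar> < e"
proof -
  obtain g where g: "real_polynomial_function g" "\<And>x. x \<in> {0..1} \<Longrightarrow> \<bar>f x - g x\<bar> < e"
    using Stone_Weierstrass_real_polynomial_function[OF _ assms] by auto
  then obtain a m where "g = (\<lambda>x. \<Sum>i\<le>m. a i * x ^ i)"
    using real_polynomial_function_iff_sum by blast
  with g that show ?thesis by auto
qed

text \<open>Both measures are concentrated on [0, 1], where polynomials are uniformly dense in the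
  continuous functions, and finite total mass turns a uniform error into an error of the
  integrals.\<close>

lemma moments_determine_integral:
  fixes f :: "real \<Rightarrow> real"
  assumes fin: "finite_measure M" "finite_measure N"
    and sets: "sets M = sets borel" "sets N = sets borel"
    and supp: "AE x in M. x \<in> {0..1}" "AE x in N. x \<in> {0..1}"
    and mom: "\<And>k. (\<integral>x. x ^ k \<partial>M) = (\<integral>x. x ^ k \<partial>N)"
    and f: "continuous_on UNIV f"
  shows "(\<integral>x. f x \<partial>M) = (\<integral>x. f x \<partial>N)"
proof -
  have [measurable]: "f \<in> borel_measurable borel"
    using f by (rule borel_measurable_continuous_onI)
  have bdd: "bounded (f ` {0..1})"
    by (intro compact_imp_bounded compact_continuous_image continuous_on_subset[OF f]) auto
  then obtain B where "\<forall>x\<in>{0..1}. \<bar>f x\<bar> \<le> B"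
    unfolding bounded_iff by (metis image_eqI real_norm_def)
  then have B: "\<And>x. x \<in> {0..1} \<Longrightarrow> \<bar>f x\<bar> \<le> B" by blast
  have 1: "\<exists>a m. integrable K f \<and> (\<forall>i. integrable K (\<lambda>x. x ^ i))" 
    if "finite_measure K" "sets K = sets borel" "AE x in K. x \<in> {0..1}" for K :: "real measure"
  proof -
    interpret finite_measure K by fact
    have [simp]: "f \<in> borel_measurable K" "\<And>i. (\<lambda>x. x ^ i) \<in> borel_measurable K"
      by (simp_all add: that cong: measurable_cong_sets)
    have "integrable K f"
      by (rule integrable_const_bound[where B=B, OF eventually_mono[OF that(3)]]) (use B in auto)
    moreover have "integrable K (\<lambda>x. x ^ i)" for i
      by (rule integrable_const_bound[where B=1, OF eventually_mono[OF that(3)]])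
        (auto simp: power_le_one)
    ultimately show ?thesis by blast
  qed
  note int = 1[OF fin(1) sets(1) supp(1)] 1[OF fin(2) sets(2) supp(2)]
  have approx: "\<bar>(\<integral>x. f x \<partial>K) - (\<Sum>i\<le>m. a i * (\<integral>x. x ^ i \<partial>K))\<bar> \<le> e * measure K UNIV"
    if K: "finite_measure K" "sets K = sets borel" "AE x in K. x \<in> {0..1}"
      and a: "\<And>x. x \<in> {0..1} \<Longrightarrow> \<bar>f x - (\<Sum>i\<le>m. a i * x ^ i)\<bar> < e"
    for K :: "real measure" and a m e
  proof -
    interpret finite_measure K by fact
    note i = 1[OF K]
    have "(\<integral>x. f x \<partial>K) - (\<Sum>i\<le>m. a i * (\<integral>x. x ^ i \<partial>K)) = (\<integral>x. f x - (\<Sum>i\<le>m. a i * x ^ i) \<partial>K)"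
      using i by (subst Bochner_Integration.integral_diff) (auto intro!: Bochner_Integration.integrable_sum)
    also have "\<bar>\<dots>\<bar> \<le> (\<integral>x. \<bar>f x - (\<Sum>i\<le>m. a i * x ^ i)\<bar> \<partial>K)"
      by (rule integral_abs_bound)
    also have "\<dots> \<le> (\<integral>x. e \<partial>K)"
      using i
      by (intro integral_mono_AE Bochner_Integration.integrable_abs Bochner_Integration.integrable_diff
          Bochner_Integration.integrable_sum eventually_mono[OF K(3) less_imp_le[OF a]]) auto
    also have "\<dots> = e * measure K UNIV"
      using sets_eq_imp_space_eq[OF K(2)] by simp
    finally show ?thesis .
  qed
  have "\<bar>(\<integral>x. f x \<partial>M) - (\<integral>x. f x \<partial>N)\<bar> \<le> e * (measure M UNIV + measure N UNIV)" if "e > 0" for e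
  proof -
    obtain a m where a: "\<And>x. x \<in> {0..1} \<Longrightarrow> \<bar>f x - (\<Sum>i\<le>m. a i * x ^ i)\<bar> < e"
      using weierstrass_polynomial[OF continuous_on_subset[OF f] \<open>e > 0\<close>] by auto
    from approx[OF fin(1) sets(1) supp(1) a] approx[OF fin(2) sets(2) supp(2) a]
    show ?thesis by (simp add: mom distrib_left)
  qed
  note bound = this
  define m where "m = measure M UNIV + measure N UNIV"
  have "m \<ge> 0" by (simp add: m_def)
  have "\<bar>(\<integral>x. f x \<partial>M) - (\<integral>x. f x \<partial>N)\<bar> \<le> 0 + e" if "e > 0" for e
  proof -
    \<comment> \<open>Dividing by m + 1 instead of m covers total mass 0.\<close>
    have "\<bar>(\<integral>x. f x \<partial>M) - (\<integral>x. f x \<partial>N)\<bar> \<le> e / (m + 1) * m"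
      using bound[of "e / (m + 1)"] \<open>m \<ge> 0\<close> that by (simp add: m_def[symmetric])
    also have "\<dots> \<le> e" using \<open>m \<ge> 0\<close> that by (simp add: divide_simps)
    finally show ?thesis by simp
  qed
  from field_le_epsilon[OF this] show ?thesis by simp
qed

lemma moments_determine_measure:
  fixes M N :: "real measure"
  assumes fin: "finite_measure M" "finite_measure N"
    and sets: "sets M = sets borel" "sets N = sets borel"
    and supp: "AE x in M. x \<in> {0..1}" "AE x in N. x \<in> {0..1}"
    and mom: "\<And>k. (\<integral>x. x ^ k \<partial>M) = (\<integral>x. x ^ k \<partial>N)"
  shows "M = N"
proof (rule cdf_unique')
  show "finite_borel_measure M" "finite_borel_measure N"
    using fin sets by (simp_all add: finite_borel_measure_def finite_borel_measure_axioms_def)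
  \<comment> \<open>Continuous ramps, equal to 1 up to a and to 0 from a + 1/k on; they tend
    pointwise to the indicator of {..a}, so their integrals recover the distribution
    function.\<close>
  define f where "f a k x = max 0 (min 1 (1 - real k * (x - a)))" for a k and x :: real
  have lim: "(\<lambda>k. \<integral>x. f a k x \<partial>K) \<longlonglongrightarrow> cdf K a"
    if "finite_measure K" "sets K = sets borel" for a and K :: "real measure"
  proof -
    interpret finite_measure K by fact
    have [measurable_cong]: "sets K = sets borel" by fact
    have "(\<lambda>k. \<integral>x. f a k x \<partial>K) \<longlonglongrightarrow> (\<integral>x. indicator {..a} x \<partial>K)"
    proof (rule integral_dominated_convergence[where w = "\<lambda>_. 1"])
      show "AE x in K. (\<lambda>k. f a k x) \<longlonglongrightarrow> indicator {..a} x"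
      proof (rule AE_I2)
        fix x
        show "(\<lambda>k. f a k x) \<longlonglongrightarrow> indicator {..a} x"
        proof (cases "x \<le> a")
          case True
          then have "f a k x = 1" for k
            by (auto simp: f_def min_def max_def mult_nonneg_nonpos not_le)
          with True show ?thesis by simp
        next
          case False
          then obtain k0 :: nat where k0: "1 / (x - a) < real k0"
            using reals_Archimedean2 by blast
          have "f a k x = 0" if "k \<ge> k0" for k
          proof -
            have "1 < real k0 * (x - a)" using k0 False by (simp add: divide_simps)
            also have "\<dots> \<le> real k * (x - a)" using that False by (intro mult_right_mono) auto
            finally show ?thesis by (simp add: f_def)
          qed
          then have "\<forall>\<^sub>F k in sequentially. f a k x = indicator {..a} x"
            using False by (auto simp: eventually_sequentially)
          then show ?thesis by (rule tendsto_eventually)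
        qed
      qed
    qed (auto simp: f_def)
    also have "(\<integral>x. indicator {..a} x \<partial>K) = cdf K a"
      by (simp add: cdf_def)
    finally show ?thesis .
  qed
  have eq: "(\<integral>x. f a k x \<partial>M) = (\<integral>x. f a k x \<partial>N)" for a k
    by (rule moments_determine_integral[OF assms]) (auto simp: f_def intro!: continuous_intros)
  show "cdf M = cdf N"
  proof
    fix a
    show "cdf M a = cdf N a"
      using LIMSEQ_unique[OF lim[OF fin(1) sets(1)]] lim[OF fin(2) sets(2), of a] eq by simp
  qed
qed

text \<open>Only one variable at a time is inverted: the other coordinates are absorbed into the measure.\<close>

lemma Laplace_determines_measure1:
  fixes M N :: "'a measure" and f :: "'a \<Rightarrow> ennreal"
  assumes fin: "finite_measure M" "finite_measure N" and sets: "sets N = sets M"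
    and f[measurable]: "f \<in> borel_measurable M" and A: "A \<in> sets borel"
    and eq: "\<And>k. (\<integral>\<^sup>+x. enn_exp_neg (f x) ^ k \<partial>M) = (\<integral>\<^sup>+x. enn_exp_neg (f x) ^ k \<partial>N)"
  shows "emeasure M (f -` A \<inter> space M) = emeasure N (f -` A \<inter> space M)"
proof -
  have [measurable_cong]: "sets N = sets M" by fact
  have sp: "space N = space M" by (rule sets_eq_imp_space_eq[OF sets])
  \<comment> \<open>The powers of exp(-f) are the moments of the [0, 1]-valued variable v, so its
    law is determined. The map inv recovers f from v; its value at 0 is \<top> because exp(-f) = 0
    exactly when f is infinite.\<close>
  define v where "v x = enn2real (enn_exp_neg (f x))" for x
  define inv where "inv y = (if y \<le> 0 then \<top> else ennreal (- ln y))" for y :: real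
  have [measurable]: "v \<in> borel_measurable M" "inv \<in> borel_measurable borel"
    unfolding v_def[abs_def] inv_def[abs_def] by measurable
  have v01: "v x \<in> {0..1}" for x
    using enn_exp_neg_le_1[of "f x"]
    by (auto simp: v_def intro: enn2real_leI)
  have v: "ennreal (v x) = enn_exp_neg (f x)" for x
    by (simp add: v_def)
  have inv_v: "inv (v x) = f x" for x
    by (cases "f x") (simp_all add: v_def inv_def enn_exp_neg_ennreal)
  have "distr M borel v = distr N borel v"
  proof (rule moments_determine_measure)
    show "finite_measure (distr M borel v)" "finite_measure (distr N borel v)"
      by (auto intro!: finite_measure.finite_measure_distr fin)
    show "AE x in distr M borel v. x \<in> {0..1}" "AE x in distr N borel v. x \<in> {0..1}"
      using v01 by (auto simp: AE_distr_iff)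
    fix k
    have "(\<integral>x. v x ^ k \<partial>M) = enn2real (\<integral>\<^sup>+x. enn_exp_neg (f x) ^ k \<partial>M)"
      using v01 by (subst integral_eq_nn_integral) (auto simp: v ennreal_power[symmetric])
    moreover have "(\<integral>x. v x ^ k \<partial>N) = enn2real (\<integral>\<^sup>+x. enn_exp_neg (f x) ^ k \<partial>N)"
      using v01 by (subst integral_eq_nn_integral) (auto simp: v ennreal_power[symmetric])
    ultimately show "(\<integral>x. x ^ k \<partial>distr M borel v) = (\<integral>x. x ^ k \<partial>distr N borel v)"
      by (simp add: integral_distr eq)
  qed auto
  then have "emeasure (distr M borel v) (inv -` A) = emeasure (distr N borel v) (inv -` A)"
    by simp
  moreover have "inv -` A \<in> sets borel"
    using measurable_sets[of inv borel borel A] A by simp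
  moreover have "v -` inv -` A = f -` A"
    using inv_v by auto
  ultimately show ?thesis by (simp add: emeasure_distr sp)
qed

text \<open>Finite-dimensional cylinders form an intersection-stable generator. Constraints M(B)
  \<in> A are imposed one at a time: the earlier ones, together with a factor exp(-M(g)), become a
  density, and the next mass is handled by the one-variable inversion.\<close>

lemma Laplace_functional_unique:
  assumes fin: "finite_measure M1" "finite_measure M2"
    and sets: "sets M1 = sets meas_space" "sets M2 = sets meas_space"
    and eq: "\<And>g. g \<in> borel_measurable borel \<Longrightarrow> (\<And>u. 0 \<le> g u) \<Longrightarrow>
      (\<integral>\<^sup>+M. enn_exp_neg (\<integral>\<^sup>+u. ennreal (g u) \<partial>M) \<partial>M1) = (\<integral>\<^sup>+M. enn_exp_neg (\<integral>\<^sup>+u. ennreal (g u) \<partial>M) \<partial>M2)"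
  shows "M1 = M2"
proof -
  have [measurable_cong]: "sets M1 = sets meas_space" "sets M2 = sets meas_space" by fact+
  have sp: "space M1 = space meas_space" "space M2 = space meas_space"
    using sets by (auto dest: sets_eq_imp_space_eq)
  define cyl where "cyl F = {M \<in> space meas_space. \<forall>(B, A)\<in>F. emeasure M B \<in> A}"
    for F :: "(real set \<times> ennreal set) set"
  have cyl_insert: "cyl (insert (B, A) F) = cyl F \<inter> ((\<lambda>M. emeasure M B) -` A \<inter> space meas_space)" for B A F
    by (auto simp: cyl_def)
  have cyl_sets: "cyl F \<in> sets meas_space" if "finite F" "F \<subseteq> sets borel \<times> sets borel" for F
    using that
  proof (induction F)
    case empty then show ?case by (simp add: cyl_def)
  next
    case (insert p F)
    obtain B A where p: "p = (B, A)" by (cases p)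
    with insert have "B \<in> sets borel" "A \<in> sets borel" by auto
    then have "(\<lambda>M. emeasure M B) -` A \<inter> space meas_space \<in> sets meas_space"
      by (intro measurable_sets[OF measurable_emeasure_meas_space])
    with insert show ?case unfolding p cyl_insert by auto
  qed
  \<comment> \<open>Keeping an arbitrary g in the claim is what makes the induction on F close: the
    moments needed for the next coordinate are instances of the hypothesis at other test
    functions.\<close>
  have key: "(\<integral>\<^sup>+M. indicator (cyl F) M * enn_exp_neg (\<integral>\<^sup>+u. ennreal (g u) \<partial>M) \<partial>M1)
      = (\<integral>\<^sup>+M. indicator (cyl F) M * enn_exp_neg (\<integral>\<^sup>+u. ennreal (g u) \<partial>M) \<partial>M2)"
    if "finite F" "F \<subseteq> sets borel \<times> sets borel" and "g \<in> borel_measurable borel" "\<And>u. 0 \<le> g u"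
    for F and g :: "real \<Rightarrow> real"
    using that
  proof (induction F arbitrary: g)
    case empty
    have "(\<integral>\<^sup>+M. indicator (cyl {}) M * enn_exp_neg (\<integral>\<^sup>+u. ennreal (g u) \<partial>M) \<partial>K)
      = (\<integral>\<^sup>+M. enn_exp_neg (\<integral>\<^sup>+u. ennreal (g u) \<partial>M) \<partial>K)"
      if "space K = space meas_space" for K
      using that by (intro nn_integral_cong) (simp add: cyl_def)
    with empty sp show ?case by (simp add: eq)
  next
    case (insert p F)
    obtain B A where p: "p = (B, A)" by (cases p)
    with insert have B[measurable]: "B \<in> sets borel" and A[measurable]: "A \<in> sets borel"
      and F: "F \<subseteq> sets borel \<times> sets borel" by auto
    note [measurable] = cyl_sets[OF \<open>finite F\<close> F] insert.prems(2)
    \<comment> \<open>The bound w \<le> 1 keeps the reweighted laws finite, as the one-variable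
      inversion demands.\<close>
    define w where "w M = indicator (cyl F) M * enn_exp_neg (\<integral>\<^sup>+u. ennreal (g u) \<partial>M)" for M
    have [measurable]: "w \<in> borel_measurable meas_space"
      unfolding w_def by measurable
    have w1: "w M \<le> 1" for M
      using enn_exp_neg_le_1 by (auto simp: w_def indicator_def)
    have fin': "finite_measure (density K w)"
      if "finite_measure K" and [measurable_cong]: "sets K = sets meas_space" for K
    proof (rule finite_measureI)
      interpret finite_measure K by fact
      have "emeasure (density K w) (space (density K w)) = (\<integral>\<^sup>+M. w M \<partial>K)"
        by (simp add: emeasure_density cong: nn_integral_cong)
      also have "\<dots> \<le> (\<integral>\<^sup>+M. 1 \<partial>K)"
        by (intro nn_integral_mono w1)
      also have "\<dots> < \<infinity>" by (simp add: less_top[symmetric])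
      finally show "emeasure (density K w) (space (density K w)) \<noteq> \<infinity>" by simp
    qed
    \<comment> \<open>The k-th power of exp(-M(B)) is absorbed by passing from g to g + k 1_B, again
      a nonnegative test function.\<close>
    have mom: "(\<integral>\<^sup>+M. enn_exp_neg (emeasure M B) ^ k \<partial>density K w)
      = (\<integral>\<^sup>+M. indicator (cyl F) M * enn_exp_neg (\<integral>\<^sup>+u. ennreal (g u + real k * indicator B u) \<partial>M) \<partial>K)"
      if [measurable_cong]: "sets K = sets meas_space" for K k
    proof -
      have "(\<integral>\<^sup>+M. enn_exp_neg (emeasure M B) ^ k \<partial>density K w) = (\<integral>\<^sup>+M. w M * enn_exp_neg (emeasure M B) ^ k \<partial>K)"
        by (rule nn_integral_density) measurable
      also have "\<dots> = (\<integral>\<^sup>+M. indicator (cyl F) M * enn_exp_neg (\<integral>\<^sup>+u. ennreal (g u + real k * indicator B u) \<partial>M) \<partial>K)"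
      proof (rule nn_integral_cong)
        fix M assume "M \<in> space K"
        then have [measurable_cong]: "sets M = sets borel"
          using sets_eq_imp_space_eq[OF that] by (simp add: space_meas_space)
        have "(\<integral>\<^sup>+u. ennreal (g u + real k * indicator B u) \<partial>M)
          = (\<integral>\<^sup>+u. ennreal (g u) + of_nat k * indicator B u \<partial>M)"
          using insert.prems(3) by (intro nn_integral_cong)
            (auto simp: indicator_def ennreal_of_nat_eq_real_of_nat)
        also have "\<dots> = (\<integral>\<^sup>+u. ennreal (g u) \<partial>M) + of_nat k * emeasure M B"
          by (subst nn_integral_add) (auto simp: nn_integral_cmult)
        finally show "w M * enn_exp_neg (emeasure M B) ^ k
          = indicator (cyl F) M * enn_exp_neg (\<integral>\<^sup>+u. ennreal (g u + real k * indicator B u) \<partial>M)"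
          by (simp add: w_def enn_exp_neg_add enn_exp_neg_mult_of_nat mult.assoc)
      qed
      finally show ?thesis .
    qed
    have "emeasure (density M1 w) ((\<lambda>M. emeasure M B) -` A \<inter> space (density M1 w))
        = emeasure (density M2 w) ((\<lambda>M. emeasure M B) -` A \<inter> space (density M1 w))"
    proof (rule Laplace_determines_measure1)
      show "(\<integral>\<^sup>+M. enn_exp_neg (emeasure M B) ^ k \<partial>density M1 w) = (\<integral>\<^sup>+M. enn_exp_neg (emeasure M B) ^ k \<partial>density M2 w)" for k
        unfolding mom[OF sets(1)] mom[OF sets(2)]
        using insert.prems by (intro insert.IH F) auto
    qed (use fin' fin sets in auto)
    then have *: "emeasure (density M1 w) ((\<lambda>M. emeasure M B) -` A \<inter> space meas_space)
        = emeasure (density M2 w) ((\<lambda>M. emeasure M B) -` A \<inter> space meas_space)"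
      by (simp add: sp)
    have "emeasure (density K w) ((\<lambda>M. emeasure M B) -` A \<inter> space meas_space)
      = (\<integral>\<^sup>+M. indicator (cyl (insert p F)) M * enn_exp_neg (\<integral>\<^sup>+u. ennreal (g u) \<partial>M) \<partial>K)"
      if [measurable_cong]: "sets K = sets meas_space" for K
    proof -
      have "(\<lambda>M. emeasure M B) -` A \<inter> space meas_space \<in> sets K"
        unfolding that by (intro measurable_sets[OF measurable_emeasure_meas_space] A B)
      then show ?thesis
        unfolding p cyl_insert by (subst emeasure_density)
          (auto intro!: nn_integral_cong simp: w_def indicator_def)
    qed
    with * sets show ?case by simp
  qed
  let ?E = "{cyl F | F. finite F \<and> F \<subseteq> sets borel \<times> sets borel}"
  have gen: "sets meas_space = sigma_sets (space meas_space) ?E"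
  proof
    show "sigma_sets (space meas_space) ?E \<subseteq> sets meas_space"
      using cyl_sets by (intro sets.sigma_sets_subset) auto
    have "(\<lambda>M. emeasure M B) -` A \<inter> {M. sets M = sets borel} = cyl {(B, A)}" for A B
      by (auto simp: cyl_def space_meas_space)
    then show "sets meas_space \<subseteq> sigma_sets (space meas_space) ?E"
      unfolding sets_meas_space space_meas_space[symmetric]
      by (intro sigma_sets_mono' subsetI) (force simp: space_meas_space)
  qed
  have cyl_Un: "cyl F \<inter> cyl G = cyl (F \<union> G)" for F G
    by (auto simp: cyl_def)
  show ?thesis
  proof (rule measure_eqI_generator_eq[where E="?E" and \<Omega>="space meas_space" and A="\<lambda>_. cyl {}"])
    show "Int_stable ?E"
    proof (rule Int_stableI)
      fix a b assume "a \<in> ?E" "b \<in> ?E"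
      then obtain F G where "a = cyl F" "finite F" "F \<subseteq> sets borel \<times> sets borel"
        "b = cyl G" "finite G" "G \<subseteq> sets borel \<times> sets borel" by blast
      then show "a \<inter> b \<in> ?E"
        by (intro CollectI exI[of _ "F \<union> G"]) (simp add: cyl_Un)
    qed
    show "?E \<subseteq> Pow (space meas_space)" by (auto simp: cyl_def)
    show "emeasure M1 X = emeasure M2 X" if "X \<in> ?E" for X
    proof -
      from that obtain F where F: "X = cyl F" "finite F" "F \<subseteq> sets borel \<times> sets borel" by blast
      \<comment> \<open>At g = 0 the exponential factor is 1, and \<open>key\<close> compares the
        masses of the cylinders themselves.\<close>
      then show ?thesis
        using key[OF F(2,3), of "\<lambda>_. 0"] cyl_sets[OF F(2,3)] sets by simp
    qed
    show "emeasure M1 (cyl {}) \<noteq> \<infinity>"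
      using finite_measure.emeasure_finite[OF fin(1)] by simp
    show "range (\<lambda>_::nat. cyl {}) \<subseteq> ?E" by auto
  qed (auto simp: gen sets cyl_def)
qed

section \<open>The Palm formula\<close>

text \<open>The difference quotient (1 - exp(-t x))/t at t = 2^{-k}. Halving t makes the sequence
  increasing, and the value 2^k at x = \<top> has the right limit as well.\<close>

definition exp_quot :: "nat \<Rightarrow> ennreal \<Rightarrow> ennreal" where
  "exp_quot k x = 2 ^ k * (1 - enn_exp_neg (ennreal (1 / 2 ^ k) * x))"

lemma ennreal_half_power_mult: "ennreal (1 / 2 ^ k) * 2 ^ k = 1"
proof -
  have "(2::ennreal) ^ k = ennreal (2 ^ k)" by (simp flip: ennreal_power)
  then show ?thesis by (simp flip: ennreal_mult)
qed

text \<open>The form in which the quotient is applied: subtraction on \<open>ennreal\<close> is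
  truncated, so the decomposition exp(-t x) + t q = 1 is inserted under integrals instead of
  differences being taken.\<close>

lemma enn_exp_neg_plus_exp_quot:
  "enn_exp_neg (ennreal (1 / 2 ^ k) * x) + ennreal (1 / 2 ^ k) * exp_quot k x = 1"
  unfolding exp_quot_def mult.assoc[symmetric] ennreal_half_power_mult
  by (subst add.commute) (simp add: diff_add_cancel_ennreal enn_exp_neg_le_1)

lemma measurable_exp_quot [measurable]: "exp_quot k \<in> borel_measurable borel"
  unfolding exp_quot_def[abs_def] by measurable

lemma exp_quot_mono: "x \<le> y \<Longrightarrow> exp_quot k x \<le> exp_quot k y"
  unfolding exp_quot_def
  by (intro mult_left_mono ennreal_minus_mono enn_exp_neg_antimono order_refl) auto

lemma exp_quot_ennreal:
  "0 \<le> x \<Longrightarrow> exp_quot k (ennreal x) = ennreal (2 ^ k * (1 - exp (- (x / 2 ^ k))))"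
proof -
  assume x: "0 \<le> x"
  have "(2::ennreal) ^ k = ennreal (2 ^ k)" by (simp flip: ennreal_power)
  moreover have "1 - ennreal (exp (- (x / 2 ^ k))) = ennreal (1 - exp (- (x / 2 ^ k)))"
    using ennreal_minus[of "exp (- (x / 2 ^ k))" 1] by simp
  ultimately show ?thesis
    using x by (simp add: exp_quot_def enn_exp_neg_ennreal ennreal_mult flip: ennreal_mult)
qed

lemma exp_quot_top: "exp_quot k \<top> = 2 ^ k"
  by (simp add: exp_quot_def ennreal_mult_top)

lemma exp_quot_le: "exp_quot k x \<le> x"
proof (cases x)
  case (real r)
  have "1 - exp (- (r / 2 ^ k)) \<le> r / 2 ^ k"
    using exp_ge_add_one_self[of "- (r / 2 ^ k)"] by linarith
  then have "2 ^ k * (1 - exp (- (r / 2 ^ k))) \<le> r"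
    by (simp add: field_simps)
  with real show ?thesis by (simp add: exp_quot_ennreal ennreal_leI)
qed simp

lemma incseq_exp_quot: "incseq (\<lambda>k. exp_quot k x)"
proof (rule incseq_SucI)
  fix k
  show "exp_quot k x \<le> exp_quot (Suc k) x"
  proof (cases x)
    case (real r)
    \<comment> \<open>Because the step is halved, the coarser exponential is the square of the finer
      one, and 1 - a^2 = (1 - a)(1 + a) is at most 2 (1 - a).\<close>
    define a where "a = exp (- (r / 2 ^ Suc k))"
    have a: "0 < a" "a \<le> 1" using real by (auto simp: a_def)
    have "exp (- (r / 2 ^ k)) = a * a"
      by (simp add: a_def mult_exp_exp)
    moreover have "2 ^ k * (1 - a * a) \<le> 2 ^ Suc k * (1 - a)"
    proof -
      have "1 - a * a = (1 - a) * (1 + a)" by (simp add: algebra_simps)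
      also have "\<dots> \<le> (1 - a) * 2" using a by (intro mult_left_mono) auto
      finally show ?thesis by simp
    qed
    ultimately show ?thesis using real
      by (simp add: exp_quot_ennreal a_def ennreal_leI)
  next
    case top
    have "(2::ennreal) ^ k \<le> 2 ^ k * 2"
      by (metis mult.right_neutral mult_left_mono one_le_numeral zero_le)
    with top show ?thesis by (simp add: exp_quot_top mult.commute)
  qed
qed

text \<open>For finite r, exp(y) \<ge> 1 + y at y = r/2^k squeezes the quotient between r/(1 +
  r/2^k) and r; for \<top> the values are the powers of 2.\<close>

lemma SUP_exp_quot: "(SUP k. exp_quot k x) = x"
proof (cases x)
  case (real r)
  have "(\<lambda>k. exp_quot k x) \<longlonglongrightarrow> x"
  proof (rule tendsto_sandwich)
    show "\<forall>\<^sub>F k in sequentially. ennreal (r / (1 + r / 2 ^ k)) \<le> exp_quot k x"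
    proof (intro always_eventually allI)
      fix k :: nat
      define y where "y = r / 2 ^ k"
      have y: "y \<ge> 0" using real by (simp add: y_def)
      have "y / (1 + y) = 1 - 1 / (1 + y)" using y by (simp add: field_simps)
      also have "\<dots> \<le> 1 - exp (- y)"
        using exp_ge_add_one_self[of y] y by (simp add: exp_minus field_simps)
      finally have "2 ^ k * (y / (1 + y)) \<le> 2 ^ k * (1 - exp (- y))"
        by (intro mult_left_mono) auto
      moreover have "2 ^ k * (y / (1 + y)) = r / (1 + r / 2 ^ k)"
        by (simp add: y_def)
      ultimately show "ennreal (r / (1 + r / 2 ^ k)) \<le> exp_quot k x"
        using real by (simp add: exp_quot_ennreal y_def ennreal_leI)
    qed
    have "(\<lambda>k. r * (1 / 2) ^ k) \<longlonglongrightarrow> r * 0"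
      by (intro tendsto_mult tendsto_const LIMSEQ_realpow_zero) auto
    then have "(\<lambda>k. r / (1 + r / 2 ^ k)) \<longlonglongrightarrow> r / (1 + 0)"
      by (intro tendsto_divide tendsto_add tendsto_const) (auto simp: power_one_over)
    then show "(\<lambda>k. ennreal (r / (1 + r / 2 ^ k))) \<longlonglongrightarrow> x"
      using real by (auto intro: tendsto_ennrealI)
  qed (use exp_quot_le in auto)
  from LIMSEQ_unique[OF this LIMSEQ_SUP[OF incseq_exp_quot]] show ?thesis by simp
next
  case top
  have "(SUP k. (2::ennreal) ^ k) = \<top>"
  proof (rule ennreal_SUP_eq_top)
    fix n :: nat
    have "real n \<le> 2 ^ n" using of_nat_less_two_power[of n, where 'a=real] by simp
    then have "ennreal (real n) \<le> ennreal (2 ^ n)" by (rule ennreal_leI)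
    then show "\<exists>i\<in>UNIV. of_nat n \<le> (2::ennreal) ^ i"
      by (auto simp: ennreal_of_nat_eq_real_of_nat simp flip: ennreal_power intro!: exI[of _ n])
  qed
  with top show ?thesis by (simp add: exp_quot_top)
qed

text \<open>In the base case of the Palm formula the step size and the argument of the quotient vary
  with the same k. Monotonicity in both makes the diagonal cofinal in the double family.\<close>

lemma SUP_exp_quot_diagonal:
  assumes "incseq a"
  shows "(SUP k. exp_quot k (a k)) = (SUP k. a k)"
proof (rule antisym)
  show "(SUP k. exp_quot k (a k)) \<le> (SUP k. a k)"
    by (intro SUP_mono) (use exp_quot_le in blast)
  show "(SUP k. a k) \<le> (SUP k. exp_quot k (a k))"
  proof (rule SUP_least)
    fix l
    have "a l = (SUP k. exp_quot k (a l))" by (simp add: SUP_exp_quot)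
    also have "\<dots> \<le> (SUP k. exp_quot k (a k))"
    proof (rule SUP_mono)
      fix k
      have "exp_quot k (a l) \<le> exp_quot (max k l) (a l)"
        using incseq_exp_quot by (rule incseqD) simp
      also have "\<dots> \<le> exp_quot (max k l) (a (max k l))"
        by (intro exp_quot_mono incseqD[OF assms]) simp
      finally show "\<exists>m\<in>UNIV. exp_quot k (a l) \<le> exp_quot m (a m)" by blast
    qed
    finally show "a l \<le> (SUP k. exp_quot k (a k))" .
  qed
qed

section \<open>Exponential damping of polynomial growth\<close>

lemma mult_enn_exp_neg_le:
  assumes "0 < e"
  shows "y * enn_exp_neg (ennreal e * y) \<le> ennreal (1 / e)"
proof (cases y)
  case (real r)
  have "e * r \<le> exp (e * r)"
    using exp_ge_add_one_self[of "e * r"] by linarith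
  then have "r * exp (- (e * r)) \<le> 1 / e"
    using assms by (simp add: exp_minus field_simps)
  with real assms show ?thesis
    by (simp add: enn_exp_neg_ennreal ennreal_leI flip: ennreal_mult)
qed (use assms in \<open>simp add: ennreal_mult_top\<close>)

text \<open>Each factor spends half of the remaining exponential damping, which is why the induction
  lets e vary.\<close>

lemma prod_enn_exp_neg_bounded:
  assumes "finite I" "\<And>i. i \<in> I \<Longrightarrow> c i < (\<top>::ennreal)" "0 < e"
  shows "\<exists>C<\<top>. \<forall>y. (\<Prod>i\<in>I. y + c i) * enn_exp_neg (ennreal e * y) \<le> C"
  using assms
proof (induction I arbitrary: e)
  case empty
  then show ?case using enn_exp_neg_le_1 by (intro exI[of _ 1]) auto
next
  case (insert i I)
  from insert.IH[of "e / 2"] insert.prems obtain C where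
    C: "C < \<top>" "\<And>y. (\<Prod>i\<in>I. y + c i) * enn_exp_neg (ennreal (e / 2) * y) \<le> C" by auto
  have "(\<Prod>i\<in>insert i I. y + c i) * enn_exp_neg (ennreal e * y) \<le> (ennreal (1 / (e / 2)) + c i) * C" for y
  proof -
    have "ennreal e = ennreal (e / 2) + ennreal (e / 2)"
      using insert.prems by (simp flip: ennreal_plus)
    then have "enn_exp_neg (ennreal e * y) = enn_exp_neg (ennreal (e / 2) * y) * enn_exp_neg (ennreal (e / 2) * y)"
      by (simp add: distrib_right enn_exp_neg_add)
    then have "(\<Prod>i\<in>insert i I. y + c i) * enn_exp_neg (ennreal e * y)
      = ((y + c i) * enn_exp_neg (ennreal (e / 2) * y)) * ((\<Prod>i\<in>I. y + c i) * enn_exp_neg (ennreal (e / 2) * y))"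
      using insert.hyps by (simp add: mult_ac)
    also have "\<dots> \<le> (ennreal (1 / (e / 2)) + c i) * C"
    proof (intro mult_mono C)
      have "y * enn_exp_neg (ennreal (e / 2) * y) \<le> ennreal (1 / (e / 2))"
        using insert.prems by (intro mult_enn_exp_neg_le) simp
      moreover have "c i * enn_exp_neg (ennreal (e / 2) * y) \<le> c i * 1"
        by (intro mult_left_mono enn_exp_neg_le_1) simp
      ultimately show "(y + c i) * enn_exp_neg (ennreal (e / 2) * y) \<le> ennreal (1 / (e / 2)) + c i"
        unfolding distrib_right by (intro add_mono) simp_all
    qed auto
    finally show ?thesis .
  qed
  moreover have "(ennreal (1 / (e / 2)) + c i) * C < \<top>"
    using C insert.prems by (simp add: ennreal_mult_less_top less_top)
  ultimately show ?case by blast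
qed

text \<open>The intensity is one measure R on pairs (location, jump size), so that a single integral
  sign suffices in all that follows. The exponent uses \<open>enn_exp_neg\<close> of a product in
  \<open>ennreal\<close>, which spares sign conditions on the jump size.\<close>

locale crm =
  fixes L :: "real measure measure" and R :: "(real \<times> real) measure"
  assumes prob: "prob_space L" and sets_L: "sets L = sets meas_space" and sets_R: "sets R = sets (borel \<Otimes>\<^sub>M borel)"
    and laplace: "\<And>h. h \<in> borel_measurable borel \<Longrightarrow> (\<And>u. 0 \<le> h u) \<Longrightarrow>
      (\<integral>\<^sup>+M. enn_exp_neg (\<integral>\<^sup>+u. ennreal (h u) \<partial>M) \<partial>L)
      = enn_exp_neg (\<integral>\<^sup>+p. 1 - enn_exp_neg (ennreal (h (fst p)) * ennreal (snd p)) \<partial>R)"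
begin

sublocale prob_space L by (rule prob)

lemmas [measurable_cong] = sets_L sets_R

lemma space_L: "space L = {M. sets M = sets borel}"
  using sets_eq_imp_space_eq[OF sets_L] by (simp add: space_meas_space)

text \<open>The Laplace exponent of L. The value \<top> is allowed and means that exp(-M(h)) has
  expectation 0.\<close>

definition psi :: "(real \<Rightarrow> real) \<Rightarrow> ennreal" where
  "psi h = (\<integral>\<^sup>+p. 1 - enn_exp_neg (ennreal (h (fst p)) * ennreal (snd p)) \<partial>R)"

lemma nn_integral_add_indicator:
  assumes "M \<in> space L" "h \<in> borel_measurable borel" "\<And>u. 0 \<le> h u" "B \<in> sets borel" "0 \<le> t"
  shows "(\<integral>\<^sup>+u. ennreal (h u + t * indicator B u) \<partial>M) = (\<integral>\<^sup>+u. ennreal (h u) \<partial>M) + ennreal t * emeasure M B"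
proof -
  have [measurable_cong]: "sets M = sets borel" using assms by (simp add: space_L)
  note [measurable] = assms(2,4)
  have "(\<integral>\<^sup>+u. ennreal (h u + t * indicator B u) \<partial>M) = (\<integral>\<^sup>+u. ennreal (h u) + ennreal t * indicator B u \<partial>M)"
    using assms by (intro nn_integral_cong) (auto simp: indicator_def)
  also have "\<dots> = (\<integral>\<^sup>+u. ennreal (h u) \<partial>M) + ennreal t * emeasure M B"
    by (subst nn_integral_add) (auto simp: nn_integral_cmult)
  finally show ?thesis .
qed

text \<open>From 1 - a b = (1 - a) + a (1 - b). The second summand is the exponent of f for the
  intensity tilted by exp(-h(u) z); this is where the tilted measure in the posterior
  originates.\<close>

lemma psi_add:
  assumes [measurable]: "h \<in> borel_measurable borel" "f \<in> borel_measurable borel"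
    and nn: "\<And>u. 0 \<le> h u" "\<And>u. 0 \<le> f u"
  shows "psi (\<lambda>u. h u + f u) = psi h + (\<integral>\<^sup>+p. enn_exp_neg (ennreal (h (fst p)) * ennreal (snd p)) *
    (1 - enn_exp_neg (ennreal (f (fst p)) * ennreal (snd p))) \<partial>R)"
proof -
  have "1 - enn_exp_neg (ennreal (h u + f u) * z) =
      1 - enn_exp_neg (ennreal (h u) * z) + enn_exp_neg (ennreal (h u) * z) * (1 - enn_exp_neg (ennreal (f u) * z))" for u z
  proof -
    have *: "1 - a * b = 1 - a + a * (1 - b)" if ab: "a \<le> 1" "b \<le> 1" for a b :: ennreal
    proof -
      obtain a' b' where "a = ennreal a'" "b = ennreal b'" "0 \<le> a'" "0 \<le> b'"
        using ab by (cases a; cases b) (auto simp: top_unique)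
      with ab show ?thesis
        by (simp add: ennreal_1[symmetric] ennreal_minus algebra_simps mult_left_le
            del: ennreal_1 flip: ennreal_mult ennreal_plus)
    qed
    have "enn_exp_neg (ennreal (h u + f u) * z) = enn_exp_neg (ennreal (h u) * z) * enn_exp_neg (ennreal (f u) * z)"
      using nn by (simp add: distrib_right enn_exp_neg_add)
    then show ?thesis by (simp add: * enn_exp_neg_le_1)
  qed
  then show ?thesis
    unfolding psi_def by (subst nn_integral_add[symmetric]) simp_all
qed

text \<open>The expectation of exp(-M(h)) is decomposed twice by exp(-t x) + t q = 1: inside the
  expectation with x = M(B), and on the closed form with t x the increment of psi in the direction t
  1_B. The first summands agree by the Laplace functional, so the difference quotients agree, and k
  tends to infinity.\<close>

lemma palm_base:
  assumes [measurable]: "h \<in> borel_measurable borel" "B \<in> sets borel" and nn: "\<And>u. 0 \<le> h u"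
  shows "(\<integral>\<^sup>+M. emeasure M B * enn_exp_neg (\<integral>\<^sup>+u. ennreal (h u) \<partial>M) \<partial>L)
    = (\<integral>\<^sup>+p. indicator B (fst p) * ennreal (snd p) * enn_exp_neg (ennreal (h (fst p)) * ennreal (snd p)) \<partial>R)
      * enn_exp_neg (psi h)"
proof -
  define E where "E M = enn_exp_neg (\<integral>\<^sup>+u. ennreal (h u) \<partial>M)" for M
  have [measurable]: "E \<in> borel_measurable meas_space" unfolding E_def by measurable
  define e where "e p = enn_exp_neg (ennreal (h (fst p)) * ennreal (snd p))" for p :: "real \<times> real"
  have [measurable]: "e \<in> borel_measurable (borel \<Otimes>\<^sub>M borel)" unfolding e_def by measurable
  define t :: "nat \<Rightarrow> real" where "t k = 1 / 2 ^ k" for k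
  have t: "0 < t k" for k by (simp add: t_def)
  define a where "a k = (\<integral>\<^sup>+p. e p * exp_quot k (indicator B (fst p) * ennreal (snd p)) \<partial>R)" for k
  have X: "(\<integral>\<^sup>+M. exp_quot k (emeasure M B) * E M \<partial>L) = enn_exp_neg (psi h) * exp_quot k (a k)" for k
  proof -
    \<comment> \<open>The increment of psi when h is replaced by h + t 1_B; it is shown to be t
      times \<open>a k\<close>.\<close>
    let ?\<Delta> = "\<integral>\<^sup>+p. e p * (1 - enn_exp_neg (ennreal (t k * indicator B (fst p)) * ennreal (snd p))) \<partial>R"
    have scale: "x * (1 - enn_exp_neg y) = ennreal (t k) * (x * (2 ^ k * (1 - enn_exp_neg y)))" for x y
    proof -
      have "ennreal (t k) * (x * (2 ^ k * (1 - enn_exp_neg y))) = (ennreal (t k) * 2 ^ k) * (x * (1 - enn_exp_neg y))"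
        by (simp add: mult_ac)
      then show ?thesis unfolding t_def ennreal_half_power_mult by simp
    qed
    have "ennreal (t k * indicator B u) * z = ennreal (t k) * (indicator B u * z)" for u z
      by (auto simp: indicator_def)
    then have "?\<Delta> = (\<integral>\<^sup>+p. ennreal (t k) * (e p * exp_quot k (indicator B (fst p) * ennreal (snd p))) \<partial>R)"
      unfolding exp_quot_def t_def[symmetric] scale[symmetric] by simp
    also have "\<dots> = ennreal (t k) * a k"
      unfolding a_def by (intro nn_integral_cmult) measurable
    finally have \<Delta>: "?\<Delta> = ennreal (t k) * a k" .
    have "enn_exp_neg (psi h) = (\<integral>\<^sup>+M. E M \<partial>L)"
      unfolding E_def psi_def by (rule laplace[symmetric]) (use nn in auto)
    also have "\<dots> = (\<integral>\<^sup>+M. enn_exp_neg (ennreal (t k) * emeasure M B) * E M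
        + ennreal (t k) * (exp_quot k (emeasure M B) * E M) \<partial>L)"
      unfolding t_def by (simp add: enn_exp_neg_plus_exp_quot flip: mult.assoc distrib_right)
    also have "\<dots> = (\<integral>\<^sup>+M. enn_exp_neg (ennreal (t k) * emeasure M B) * E M \<partial>L)
        + ennreal (t k) * (\<integral>\<^sup>+M. exp_quot k (emeasure M B) * E M \<partial>L)"
      by (subst nn_integral_add) (simp_all add: nn_integral_cmult)
    also have "(\<integral>\<^sup>+M. enn_exp_neg (ennreal (t k) * emeasure M B) * E M \<partial>L)
        = (\<integral>\<^sup>+M. enn_exp_neg (\<integral>\<^sup>+u. ennreal (h u + t k * indicator B u) \<partial>M) \<partial>L)"
      using t[of k] nn unfolding E_def
      by (intro nn_integral_cong, subst nn_integral_add_indicator) (auto simp: enn_exp_neg_add mult.commute)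
    also have "\<dots> = enn_exp_neg (psi (\<lambda>u. h u + t k * indicator B u))"
      unfolding psi_def using t[of k] nn by (intro laplace) auto
    also have "psi (\<lambda>u. h u + t k * indicator B u) = psi h + ennreal (t k) * a k"
      unfolding \<Delta>[symmetric] e_def using t[of k] nn by (intro psi_add) auto
    finally have "enn_exp_neg (psi h) = enn_exp_neg (psi h) * enn_exp_neg (ennreal (t k) * a k)
        + ennreal (t k) * (\<integral>\<^sup>+M. exp_quot k (emeasure M B) * E M \<partial>L)"
      unfolding enn_exp_neg_add .
    moreover have "enn_exp_neg (psi h) = enn_exp_neg (psi h) * enn_exp_neg (ennreal (t k) * a k)
        + ennreal (t k) * (enn_exp_neg (psi h) * exp_quot k (a k))"
      using enn_exp_neg_plus_exp_quot[of k "a k"]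
      unfolding t_def by (metis distrib_left mult.left_commute mult.right_neutral)
    ultimately have "enn_exp_neg (psi h) * enn_exp_neg (ennreal (t k) * a k)
        + ennreal (t k) * (\<integral>\<^sup>+M. exp_quot k (emeasure M B) * E M \<partial>L)
      = enn_exp_neg (psi h) * enn_exp_neg (ennreal (t k) * a k)
        + ennreal (t k) * (enn_exp_neg (psi h) * exp_quot k (a k))" by simp
    \<comment> \<open>The common summand is a product of two values of \<open>enn_exp_neg\<close>,
      hence finite, which makes the cancellation legitimate.\<close>
    then have "ennreal (t k) * (\<integral>\<^sup>+M. exp_quot k (emeasure M B) * E M \<partial>L)
      = ennreal (t k) * (enn_exp_neg (psi h) * exp_quot k (a k))"
      by (subst (asm) ennreal_add_left_cancel) (auto simp: ennreal_mult_eq_top_iff)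
    then show ?thesis
      using t[of k] by (subst (asm) ennreal_mult_cancel_left) auto
  qed
  have inc: "incseq a"
    unfolding a_def incseq_def le_fun_def
    by (auto intro!: nn_integral_mono mult_left_mono incseqD[OF incseq_exp_quot])
  have "(\<integral>\<^sup>+M. emeasure M B * E M \<partial>L) = (\<integral>\<^sup>+M. (SUP k. exp_quot k (emeasure M B) * E M) \<partial>L)"
    by (simp add: SUP_mult_right_ennreal[symmetric] SUP_exp_quot)
  also have "\<dots> = (SUP k. \<integral>\<^sup>+M. exp_quot k (emeasure M B) * E M \<partial>L)"
    by (intro nn_integral_monotone_convergence_SUP)
      (auto simp: incseq_def le_fun_def intro!: mult_right_mono incseqD[OF incseq_exp_quot])
  also have "\<dots> = enn_exp_neg (psi h) * (SUP k. exp_quot k (a k))"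
    unfolding X by (simp add: SUP_mult_left_ennreal)
  \<comment> \<open>On this side k occurs both in the quotient and in its argument.\<close>
  also have "(SUP k. exp_quot k (a k)) = (SUP k. a k)"
    by (rule SUP_exp_quot_diagonal[OF inc])
  also have "(SUP k. a k) = (\<integral>\<^sup>+p. (SUP k. e p * exp_quot k (indicator B (fst p) * ennreal (snd p))) \<partial>R)"
    unfolding a_def by (intro nn_integral_monotone_convergence_SUP[symmetric])
      (auto simp: incseq_def le_fun_def intro!: mult_left_mono incseqD[OF incseq_exp_quot])
  also have "\<dots> = (\<integral>\<^sup>+p. indicator B (fst p) * ennreal (snd p) * e p \<partial>R)"
    by (simp add: SUP_mult_left_ennreal[symmetric] SUP_exp_quot mult_ac)
  finally show ?thesis by (simp add: E_def e_def mult.commute)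
qed

text \<open>On D the test function is at least e, so M(h) dominates e M(D), while the product is
  bounded by a polynomial in M(D); the integrand is then bounded by a constant even where M(D) has
  no moments.\<close>

lemma moment_finite:
  assumes "finite I" "\<And>i. i \<in> I \<Longrightarrow> B i \<subseteq> D" "\<And>i. i \<in> I \<Longrightarrow> c i < \<top>"
    and [measurable]: "D \<in> sets borel" and h: "\<And>u. u \<in> D \<Longrightarrow> e \<le> h u" "0 < e"
  shows "(\<integral>\<^sup>+M. (\<Prod>i\<in>I. emeasure M (B i) + c i) * enn_exp_neg (\<integral>\<^sup>+u. ennreal (h u) \<partial>M) \<partial>L) < \<top>"
proof -
  obtain C where C: "C < \<top>" "\<And>y. (\<Prod>i\<in>I. y + c i) * enn_exp_neg (ennreal e * y) \<le> C"
    using prod_enn_exp_neg_bounded[of I c e] assms(1,3) h(2) by auto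
  have "(\<integral>\<^sup>+M. (\<Prod>i\<in>I. emeasure M (B i) + c i) * enn_exp_neg (\<integral>\<^sup>+u. ennreal (h u) \<partial>M) \<partial>L) \<le> (\<integral>\<^sup>+M. C \<partial>L)"
  proof (rule nn_integral_mono)
    fix M assume "M \<in> space L"
    then have M: "sets M = sets borel" by (simp add: space_L)
    have "ennreal e * emeasure M D = (\<integral>\<^sup>+u. ennreal e * indicator D u \<partial>M)"
      using M by (simp add: nn_integral_cmult_indicator)
    also have "\<dots> \<le> (\<integral>\<^sup>+u. ennreal (h u) \<partial>M)"
      using h(1) by (intro nn_integral_mono) (auto simp: indicator_def ennreal_leI)
    finally have "(\<Prod>i\<in>I. emeasure M (B i) + c i) * enn_exp_neg (\<integral>\<^sup>+u. ennreal (h u) \<partial>M)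
      \<le> (\<Prod>i\<in>I. emeasure M D + c i) * enn_exp_neg (ennreal e * emeasure M D)"
      using M assms(2) by (intro mult_mono prod_mono_ennreal add_mono emeasure_mono enn_exp_neg_antimono) auto
    also have "\<dots> \<le> C" by (rule C)
    finally show "(\<Prod>i\<in>I. emeasure M (B i) + c i) * enn_exp_neg (\<integral>\<^sup>+u. ennreal (h u) \<partial>M) \<le> C" .
  qed
  also have "\<dots> < \<top>" using C by (simp add: emeasure_space_1)
  finally show ?thesis .
qed


text \<open>Differentiating the identity for \<^term>\<open>I\<close> in the direction of \<^term>\<open>indicator (B b)\<close> adds the
  factor for \<^term>\<open>b\<close>; the lower bound on \<^term>\<open>h\<close> keeps everything finite, so that the
  common part of the difference quotients cancels.\<close>

lemma palm:
  assumes "finite I" "\<And>i. i \<in> I \<Longrightarrow> B i \<in> sets borel" "\<And>i. i \<in> I \<Longrightarrow> B i \<subseteq> D" "\<And>i. i \<in> I \<Longrightarrow> c i < \<top>"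
    and D: "D \<in> sets borel" "B0 \<in> sets borel" "B0 \<subseteq> D"
    and h: "h \<in> borel_measurable borel" "\<And>u. 0 \<le> h u" "\<And>u. u \<in> D \<Longrightarrow> e \<le> h u" "0 < e"
  shows "(\<integral>\<^sup>+M. emeasure M B0 * (\<Prod>i\<in>I. emeasure M (B i) + c i) * enn_exp_neg (\<integral>\<^sup>+u. ennreal (h u) \<partial>M) \<partial>L)
    = (\<integral>\<^sup>+p. indicator B0 (fst p) * ennreal (snd p) * enn_exp_neg (ennreal (h (fst p)) * ennreal (snd p)) *
        (\<integral>\<^sup>+M. (\<Prod>i\<in>I. emeasure M (B i) + (c i + ennreal (snd p) * indicator (B i) (fst p)))
          * enn_exp_neg (\<integral>\<^sup>+u. ennreal (h u) \<partial>M) \<partial>L) \<partial>R)"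
  using assms(1-4) h
proof (induction I arbitrary: h)
  case empty
  then have [measurable]: "h \<in> borel_measurable borel" by simp
  note [measurable] = D
  have "(\<integral>\<^sup>+M. enn_exp_neg (\<integral>\<^sup>+u. ennreal (h u) \<partial>M) \<partial>L) = enn_exp_neg (psi h)"
    unfolding psi_def by (rule laplace) (use empty in auto)
  then show ?case
    using palm_base[of h B0] empty D by (simp add: nn_integral_multc)
next
  case (insert b I)
  note [measurable] = D insert.prems(4)
  have [measurable]: "B i \<in> sets borel" if "i \<in> I" for i using insert.prems(1) that by auto
  have [measurable]: "B b \<in> sets borel" using insert.prems(1) by auto
  define t :: "nat \<Rightarrow> real" where "t k = 1 / 2 ^ k" for k
  have t: "0 < t k" for k by (simp add: t_def)
  define E where "E h M = enn_exp_neg (\<integral>\<^sup>+u. ennreal (h u) \<partial>M)" for h and M :: "real measure"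
  define w where "w h p = indicator B0 (fst p) * ennreal (snd p) * enn_exp_neg (ennreal (h (fst p)) * ennreal (snd p))"
    for h :: "real \<Rightarrow> real" and p :: "real \<times> real"
  define F where "F M = (\<Prod>i\<in>I. emeasure M (B i) + c i)" for M
  define G where "G p M = (\<Prod>i\<in>I. emeasure M (B i) + (c i + ennreal (snd p) * indicator (B i) (fst p)))" for p M
  \<comment> \<open>The new factor, without and with the extra atom p = (location, size) added to
    M.\<close>
  define y where "y M = emeasure M (B b) + c b" for M
  define y' where "y' p M = emeasure M (B b) + (c b + ennreal (snd p) * indicator (B b) (fst p))" for p M
  have [measurable]: "E h \<in> borel_measurable meas_space" if [measurable]: "h \<in> borel_measurable borel" for h
    unfolding E_def by measurable
  have [measurable]: "w h \<in> borel_measurable (borel \<Otimes>\<^sub>M borel)" if [measurable]: "h \<in> borel_measurable borel" for h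
    unfolding w_def by measurable
  have [measurable]: "F \<in> borel_measurable meas_space" "y \<in> borel_measurable meas_space"
    unfolding F_def y_def by measurable
  have [measurable]: "(\<lambda>(p, M). G p M) \<in> borel_measurable ((borel \<Otimes>\<^sub>M borel) \<Otimes>\<^sub>M meas_space)"
    "(\<lambda>(p, M). y' p M) \<in> borel_measurable ((borel \<Otimes>\<^sub>M borel) \<Otimes>\<^sub>M meas_space)"
    unfolding G_def y'_def by measurable
  define hk where "hk k u = h u + t k * indicator (B b) u" for k u
  have hk[measurable]: "hk k \<in> borel_measurable borel" for k
    unfolding hk_def by measurable
  have hk0: "0 \<le> hk k u" for k u using insert.prems(5) t[of k] by (simp add: hk_def)
  have IH: "(\<integral>\<^sup>+M. emeasure M B0 * F M * E h M \<partial>L) = (\<integral>\<^sup>+p. w h p * (\<integral>\<^sup>+M. G p M * E h M \<partial>L) \<partial>R)"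
    "(\<integral>\<^sup>+M. emeasure M B0 * F M * E (hk k) M \<partial>L) = (\<integral>\<^sup>+p. w (hk k) p * (\<integral>\<^sup>+M. G p M * E (hk k) M \<partial>L) \<partial>R)" for k
  proof -
    show "(\<integral>\<^sup>+M. emeasure M B0 * F M * E h M \<partial>L) = (\<integral>\<^sup>+p. w h p * (\<integral>\<^sup>+M. G p M * E h M \<partial>L) \<partial>R)"
      unfolding F_def E_def w_def G_def by (rule insert.IH) (use insert.prems in auto)
    have "e \<le> hk k u" if "u \<in> D" for u
      using insert.prems(6)[OF that] t[of k] by (auto simp: hk_def indicator_def)
    then show "(\<integral>\<^sup>+M. emeasure M B0 * F M * E (hk k) M \<partial>L) = (\<integral>\<^sup>+p. w (hk k) p * (\<integral>\<^sup>+M. G p M * E (hk k) M \<partial>L) \<partial>R)"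
      unfolding F_def E_def w_def G_def by (intro insert.IH) (use insert.prems hk0 in auto)
  qed
  have E_hk: "E (hk k) M = enn_exp_neg (ennreal (t k) * emeasure M (B b)) * E h M" if "M \<in> space L" for k M
    unfolding E_def hk_def using insert.prems(4,5) t[of k] that
    by (subst nn_integral_add_indicator) (auto simp: enn_exp_neg_add mult.commute)
  have w_hk: "w (hk k) p = enn_exp_neg (ennreal (t k) * (ennreal (snd p) * indicator (B b) (fst p))) * w h p" for k p
  proof -
    have "ennreal (hk k (fst p)) * ennreal (snd p)
      = ennreal (h (fst p)) * ennreal (snd p) + ennreal (t k) * (ennreal (snd p) * indicator (B b) (fst p))"
      using insert.prems(5) t[of k] by (auto simp: hk_def indicator_def distrib_right)
    then show ?thesis unfolding w_def by (simp add: enn_exp_neg_add mult_ac)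
  qed
  have split: "x = enn_exp_neg (ennreal (t k) * y) * x + ennreal (t k) * (x * exp_quot k y)" for x k y
    using enn_exp_neg_plus_exp_quot[of k y] unfolding t_def
    by (metis (no_types, lifting) distrib_right mult.assoc mult.commute mult_1)
  have X: "(\<integral>\<^sup>+M. emeasure M B0 * F M * E h M * exp_quot k (y M) \<partial>L)
      = (\<integral>\<^sup>+p. w h p * (\<integral>\<^sup>+M. G p M * E h M * exp_quot k (y' p M) \<partial>L) \<partial>R)" for k
  proof -
    let ?X = "\<integral>\<^sup>+M. emeasure M B0 * F M * E h M * exp_quot k (y M) \<partial>L"
    let ?Y = "\<integral>\<^sup>+p. w h p * (\<integral>\<^sup>+M. G p M * E h M * exp_quot k (y' p M) \<partial>L) \<partial>R"
    \<comment> \<open>The part common to both decompositions. On the left exp(-t y) turns h into h +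
      t 1_B and leaves exp(-t c_b). On the right exp(-t y') also contains the contribution of the
      atom, which turns the weight of h into that of h + t 1_B. The induction hypothesis at the
      shifted function identifies the two.\<close>
    let ?C = "enn_exp_neg (ennreal (t k) * c b) * (\<integral>\<^sup>+M. emeasure M B0 * F M * E (hk k) M \<partial>L)"
    have "(\<integral>\<^sup>+M. emeasure M B0 * F M * E h M \<partial>L)
      = (\<integral>\<^sup>+M. enn_exp_neg (ennreal (t k) * c b) * (emeasure M B0 * F M * E (hk k) M)
          + ennreal (t k) * (emeasure M B0 * F M * E h M * exp_quot k (y M)) \<partial>L)"
    proof (rule nn_integral_cong)
      fix M assume M: "M \<in> space L"
      show "emeasure M B0 * F M * E h M = enn_exp_neg (ennreal (t k) * c b) * (emeasure M B0 * F M * E (hk k) M)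
          + ennreal (t k) * (emeasure M B0 * F M * E h M * exp_quot k (y M))"
        by (subst split[of _ k "y M"]) (simp add: E_hk[OF M] y_def distrib_left enn_exp_neg_add mult_ac)
    qed
    also have "\<dots> = ?C + ennreal (t k) * ?X"
      by (subst nn_integral_add) (simp_all add: nn_integral_cmult)
    finally have 1: "(\<integral>\<^sup>+M. emeasure M B0 * F M * E h M \<partial>L) = ?C + ennreal (t k) * ?X" .
    have "(\<integral>\<^sup>+M. G p M * E h M \<partial>L) =
        enn_exp_neg (ennreal (t k) * c b) * enn_exp_neg (ennreal (t k) * (ennreal (snd p) * indicator (B b) (fst p)))
          * (\<integral>\<^sup>+M. G p M * E (hk k) M \<partial>L)
        + ennreal (t k) * (\<integral>\<^sup>+M. G p M * E h M * exp_quot k (y' p M) \<partial>L)" (is "_ = ?k * _ + _") for p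
    proof -
      have "p \<in> space (borel \<Otimes>\<^sub>M borel)" by (simp add: space_pair_measure)
      note [measurable] = this
      have "(\<integral>\<^sup>+M. G p M * E h M \<partial>L) = (\<integral>\<^sup>+M. ?k * (G p M * E (hk k) M) + ennreal (t k) * (G p M * E h M * exp_quot k (y' p M)) \<partial>L)"
      proof (rule nn_integral_cong)
        fix M assume M: "M \<in> space L"
        show "G p M * E h M = ?k * (G p M * E (hk k) M) + ennreal (t k) * (G p M * E h M * exp_quot k (y' p M))"
          by (subst split[of _ k "y' p M"]) (simp add: E_hk[OF M] y'_def distrib_left enn_exp_neg_add mult_ac)
      qed
      also have "\<dots> = ?k * (\<integral>\<^sup>+M. G p M * E (hk k) M \<partial>L) + ennreal (t k) * (\<integral>\<^sup>+M. G p M * E h M * exp_quot k (y' p M) \<partial>L)"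
        by (subst nn_integral_add) (simp_all add: nn_integral_cmult)
      finally show ?thesis .
    qed
    then have "(\<integral>\<^sup>+p. w h p * (\<integral>\<^sup>+M. G p M * E h M \<partial>L) \<partial>R)
      = (\<integral>\<^sup>+p. enn_exp_neg (ennreal (t k) * c b) * (w (hk k) p * (\<integral>\<^sup>+M. G p M * E (hk k) M \<partial>L))
        + ennreal (t k) * (w h p * (\<integral>\<^sup>+M. G p M * E h M * exp_quot k (y' p M) \<partial>L)) \<partial>R)"
      unfolding w_hk by (intro nn_integral_cong) (simp add: distrib_left mult_ac)
    also have "\<dots> = ?C + ennreal (t k) * ?Y"
      unfolding IH by (subst nn_integral_add) (simp_all add: nn_integral_cmult)
    finally have 2: "(\<integral>\<^sup>+p. w h p * (\<integral>\<^sup>+M. G p M * E h M \<partial>L) \<partial>R) = ?C + ennreal (t k) * ?Y" .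
    \<comment> \<open>The factor for B0 is adjoined under the new index \<open>None\<close> with
      constant 0, so that \<open>moment_finite\<close> covers the full product and \<open>?C\<close>
      can be cancelled.\<close>
    have "(\<integral>\<^sup>+M. (\<Prod>i\<in>insert None (Some ` I). emeasure M (case_option B0 B i) + case_option 0 c i)
      * enn_exp_neg (\<integral>\<^sup>+u. ennreal (hk k u) \<partial>M) \<partial>L) < \<top>"
    proof (rule moment_finite)
      show "e \<le> hk k u" if "u \<in> D" for u
        using insert.prems(6)[OF that] t[of k] by (auto simp: hk_def indicator_def)
    qed (use insert D in \<open>auto split: option.splits\<close>)
    then have "(\<integral>\<^sup>+M. emeasure M B0 * F M * E (hk k) M \<partial>L) < \<top>"
      using insert.hyps by (simp add: F_def E_def prod.reindex)
    then have "?C < \<top>" by (simp add: ennreal_mult_less_top)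
    moreover have "?C + ennreal (t k) * ?X = ?C + ennreal (t k) * ?Y"
      unfolding 1[symmetric] 2[symmetric] by (rule IH(1))
    ultimately have "ennreal (t k) * ?X = ennreal (t k) * ?Y"
      by (subst (asm) ennreal_add_left_cancel) auto
    then show ?thesis
      using t[of k] by (subst (asm) ennreal_mult_cancel_left) auto
  qed
  have "(\<integral>\<^sup>+M. emeasure M B0 * F M * E h M * y M \<partial>L)
    = (\<integral>\<^sup>+M. (SUP k. emeasure M B0 * F M * E h M * exp_quot k (y M)) \<partial>L)"
    by (simp add: SUP_mult_left_ennreal[symmetric] SUP_exp_quot)
  also have "\<dots> = (SUP k. \<integral>\<^sup>+M. emeasure M B0 * F M * E h M * exp_quot k (y M) \<partial>L)"
    by (intro nn_integral_monotone_convergence_SUP)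
      (auto simp: incseq_def le_fun_def intro!: mult_left_mono incseqD[OF incseq_exp_quot])
  also have "\<dots> = (\<integral>\<^sup>+p. (SUP k. w h p * (\<integral>\<^sup>+M. G p M * E h M * exp_quot k (y' p M) \<partial>L)) \<partial>R)"
    unfolding X by (intro nn_integral_monotone_convergence_SUP[symmetric])
      (auto simp: incseq_def le_fun_def intro!: mult_left_mono nn_integral_mono incseqD[OF incseq_exp_quot])
  also have "\<dots> = (\<integral>\<^sup>+p. w h p * (\<integral>\<^sup>+M. G p M * E h M * y' p M \<partial>L) \<partial>R)"
  proof (rule nn_integral_cong)
    fix p :: "real \<times> real"
    have "p \<in> space (borel \<Otimes>\<^sub>M borel)" by (simp add: space_pair_measure)
    note [measurable] = this
    have "(SUP k. \<integral>\<^sup>+M. G p M * E h M * exp_quot k (y' p M) \<partial>L)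
      = (\<integral>\<^sup>+M. (SUP k. G p M * E h M * exp_quot k (y' p M)) \<partial>L)"
      by (intro nn_integral_monotone_convergence_SUP[symmetric])
        (auto simp: incseq_def le_fun_def intro!: mult_left_mono incseqD[OF incseq_exp_quot])
    then show "(SUP k. w h p * (\<integral>\<^sup>+M. G p M * E h M * exp_quot k (y' p M) \<partial>L)) = w h p * (\<integral>\<^sup>+M. G p M * E h M * y' p M \<partial>L)"
      by (simp add: SUP_mult_left_ennreal[symmetric] SUP_exp_quot)
  qed
  finally show ?case
    using insert.hyps by (simp add: F_def E_def G_def w_def y_def y'_def mult_ac)
qed

end

section \<open>Sums over S-paths\<close>

text \<open>Initial segments of paths: the end value is free, so n - S n indices may still wait for
  a later jump. The value 0 beyond n makes every segment a unique function and the set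
  finite.\<close>

definition partial_paths :: "nat \<Rightarrow> (nat \<Rightarrow> nat) set" where
  "partial_paths n = {S. S 0 = 0 \<and> (\<forall>j<n. S j \<le> S (Suc j)) \<and> (\<forall>j\<le>n. S j \<le> j) \<and> (\<forall>j>n. S j = 0)}"

text \<open>With K m j the integral of kappa_m beyond T_j this is \<open>phi\<close>. The kernel is
  left abstract because the same sum is needed with g_N perturbed by f. The binomial coefficient
  counts the choices of companions of j among the earlier indices not yet assigned.\<close>

definition path_weight :: "(nat \<Rightarrow> nat \<Rightarrow> ennreal) \<Rightarrow> nat \<Rightarrow> (nat \<Rightarrow> nat) \<Rightarrow> ennreal" where
  "path_weight K n S = (\<Prod>j\<in>jumps n S. of_nat ((j - 1 - S (j - 1)) choose (j - S j)) * K (incr S j) j)"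

lemma finite_jumps [simp]: "finite (jumps n S)"
  by (simp add: jumps_def)

lemma partial_paths_0: "partial_paths 0 = {\<lambda>_. 0}"
  by (auto simp: partial_paths_def) (metis gr0I)

lemma bij_betw_partial_paths_Suc:
  "bij_betw (\<lambda>(S, s). S(Suc n := s)) (SIGMA S:partial_paths n. {S n..Suc n}) (partial_paths (Suc n))"
proof (rule bij_betwI[where g = "\<lambda>S. (S(Suc n := 0), S (Suc n))"])
  show "(\<lambda>(S, s). S(Suc n := s)) \<in> (SIGMA S:partial_paths n. {S n..Suc n}) \<rightarrow> partial_paths (Suc n)"
    by (auto simp: partial_paths_def less_Suc_eq le_Suc_eq)
  show "(\<lambda>S. (S(Suc n := 0), S (Suc n))) \<in> partial_paths (Suc n) \<rightarrow> (SIGMA S:partial_paths n. {S n..Suc n})"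
    by (auto simp: partial_paths_def less_Suc_eq le_Suc_eq)
  show "(\<lambda>S. (S(Suc n := 0), S (Suc n))) ((\<lambda>(S, s). S(Suc n := s)) x) = x"
    if "x \<in> (SIGMA S:partial_paths n. {S n..Suc n})" for x
    using that by (auto simp: partial_paths_def fun_eq_iff)
qed auto

lemma finite_partial_paths [simp]: "finite (partial_paths n)"
proof (induction n)
  case (Suc n)
  then have "finite (SIGMA S:partial_paths n. {S n..Suc n})" by auto
  with bij_betw_finite[OF bij_betw_partial_paths_Suc[of n]] show ?case by simp
qed (simp add: partial_paths_0)

text \<open>\<open>is_Spath\<close> imposes monotonicity only from index 1 and the bound only below
  n; at the two ends both follow from S 0 = 0 and S n = n.\<close>

lemma Spaths_eq: "Spaths n = {S \<in> partial_paths n. S n = n}"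
proof -
  have "is_Spath n S \<longleftrightarrow> S \<in> partial_paths n \<and> S n = n" for S
  proof
    assume S: "is_Spath n S"
    have "S j \<le> S (Suc j)" if "j < n" for j
      using S that by (cases "j = 0") (auto simp: is_Spath_def)
    moreover have "S j \<le> j" if "j \<le> n" for j
      using S that by (cases "j = 0"; cases "j = n") (auto simp: is_Spath_def)
    ultimately show "S \<in> partial_paths n \<and> S n = n"
      using S by (auto simp: is_Spath_def partial_paths_def)
  qed (auto simp: is_Spath_def partial_paths_def)
  then show ?thesis by (auto simp: Spaths_def)
qed

lemma finite_Spaths [simp]: "finite (Spaths n)"
  by (simp add: Spaths_eq)

lemma path_weight_Suc:
  assumes "S n \<le> s"
  shows "path_weight K (Suc n) (S(Suc n := s)) = path_weight K n S *
    (if S n < s then of_nat ((n - S n) choose (Suc n - s)) * K (s - S n) (Suc n) else 1)"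
proof -
  let ?S = "S(Suc n := s)"
  have incr: "incr ?S (Suc n) = s - S n" "j \<le> n \<Longrightarrow> incr ?S j = incr S j" for j
    by (auto simp: incr_def)
  have jumps: "jumps (Suc n) ?S = (if S n < s then insert (Suc n) (jumps n S) else jumps n S)"
    using assms incr by (auto simp: jumps_def le_Suc_eq)
  have old: "(\<Prod>j\<in>jumps n S. of_nat ((j - 1 - ?S (j - 1)) choose (j - ?S j)) * K (incr ?S j) j) = path_weight K n S"
    unfolding path_weight_def by (rule prod.cong) (auto simp: jumps_def incr)
  have "Suc n \<notin> jumps n S" by (simp add: jumps_def)
  then show ?thesis
    unfolding path_weight_def[of K "Suc n"] jumps
    by (cases "S n < s") (simp_all only: if_True if_False old prod.insert finite_jumps incr
      not_False_eq_True, simp_all add: mult.commute)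
qed

text \<open>Here \<^term>\<open>n - S n\<close> counts the indices up to \<^term>\<open>n\<close> which have not
  been assigned yet to a jump; each carries a factor \<^term>\<open>x\<close>.\<close>

definition path_sum :: "(nat \<Rightarrow> nat \<Rightarrow> ennreal) \<Rightarrow> nat \<Rightarrow> ennreal \<Rightarrow> ennreal" where
  "path_sum K n x = (\<Sum>S\<in>partial_paths n. x ^ (n - S n) * path_weight K n S)"

lemma path_sum_0: "path_sum K 0 x = 1"
  by (simp add: path_sum_def partial_paths_0 path_weight_def jumps_def)

text \<open>By 0^0 = 1 only the segments without waiting indices survive, and these are the
  S-paths.\<close>

lemma path_sum_zero: "path_sum K n 0 = (\<Sum>S\<in>Spaths n. path_weight K n S)"
proof -
  have "path_sum K n 0 = (\<Sum>S\<in>partial_paths n. if S n = n then path_weight K n S else 0)"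
    unfolding path_sum_def
  proof (rule sum.cong)
    fix S assume "S \<in> partial_paths n"
    then have "S n \<le> n" by (simp add: partial_paths_def)
    then show "0 ^ (n - S n) * path_weight K n S = (if S n = n then path_weight K n S else 0)"
      by (simp add: power_0_left)
  qed simp
  then show ?thesis by (simp add: Spaths_eq sum.If_cases Int_def)
qed

text \<open>Index n + 1 either waits, contributing x, or receives a jump of size k + 1 shared with k
  of the n - S n waiting indices. The inner sum has the shape of z (x + z)^{n - S n} expanded, with
  z^{k + 1} replaced by K (k + 1) (n + 1).\<close>

lemma path_sum_Suc:
  "path_sum K (Suc n) x = x * path_sum K n x +
    (\<Sum>S\<in>partial_paths n. path_weight K n S *
      (\<Sum>k\<le>n - S n. of_nat ((n - S n) choose k) * x ^ (n - S n - k) * K (Suc k) (Suc n)))"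
proof -
  have inner: "(\<Sum>s\<in>{S n..Suc n}. x ^ (Suc n - s) * path_weight K (Suc n) (S(Suc n := s)))
    = x * (x ^ (n - S n) * path_weight K n S) + path_weight K n S *
      (\<Sum>k\<le>n - S n. of_nat ((n - S n) choose k) * x ^ (n - S n - k) * K (Suc k) (Suc n))"
    if "S \<in> partial_paths n" for S
  proof -
    from that have S: "S n \<le> n" by (simp add: partial_paths_def)
    have "(\<Sum>s\<in>{S n..Suc n}. x ^ (Suc n - s) * path_weight K (Suc n) (S(Suc n := s)))
      = x ^ (Suc n - S n) * path_weight K (Suc n) (S(Suc n := S n))
      + (\<Sum>s\<in>{Suc (S n)..Suc n}. x ^ (Suc n - s) * path_weight K (Suc n) (S(Suc n := s)))"
      using S by (subst sum.atLeast_Suc_atMost) auto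
    also have "x ^ (Suc n - S n) * path_weight K (Suc n) (S(Suc n := S n)) = x * (x ^ (n - S n) * path_weight K n S)"
      using S by (simp add: path_weight_Suc Suc_diff_le mult_ac)
    also have "(\<Sum>s\<in>{Suc (S n)..Suc n}. x ^ (Suc n - s) * path_weight K (Suc n) (S(Suc n := s)))
      = (\<Sum>s\<in>{Suc (S n)..Suc n}. path_weight K n S *
          (of_nat ((n - S n) choose (Suc n - s)) * x ^ (Suc n - s) * K (s - S n) (Suc n)))"
      by (rule sum.cong) (simp_all add: path_weight_Suc mult_ac)
    also have "\<dots> = (\<Sum>k\<le>n - S n. path_weight K n S *
        (of_nat ((n - S n) choose k) * x ^ (n - S n - k) * K (Suc k) (Suc n)))"
      using S
    proof (intro sum.reindex_bij_witness[where j = "\<lambda>s. s - Suc (S n)" and i = "\<lambda>k. Suc (S n) + k"], goal_cases)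
      case (5 s)
      then have s: "Suc n - s = n - S n - (s - Suc (S n))" "s - S n = Suc (s - Suc (S n))" "s - Suc (S n) \<le> n - S n"
        by auto
      \<comment> \<open>The weight counts the indices that keep waiting, the expansion those that
        join the jump; symmetry of the binomial coefficient reconciles the two.\<close>
      have "(n - S n) choose (s - Suc (S n)) = (n - S n) choose (n - S n - (s - Suc (S n)))"
        using s(3) by (rule binomial_symmetric)
      with s(1,2) show ?case by simp
    qed auto
    finally show ?thesis by (simp only: sum_distrib_left)
  qed
  have "path_sum K (Suc n) x
    = (\<Sum>(S, s)\<in>(SIGMA S:partial_paths n. {S n..Suc n}). x ^ (Suc n - s) * path_weight K (Suc n) (S(Suc n := s)))"
    unfolding path_sum_def
    by (subst sum.reindex_bij_betw[OF bij_betw_partial_paths_Suc, symmetric]) (simp add: case_prod_beta)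
  also have "\<dots> = (\<Sum>S\<in>partial_paths n. \<Sum>s\<in>{S n..Suc n}. x ^ (Suc n - s) * path_weight K (Suc n) (S(Suc n := s)))"
    by (rule sum.Sigma[symmetric]) auto
  also have "\<dots> = (\<Sum>S\<in>partial_paths n. x * (x ^ (n - S n) * path_weight K n S) + path_weight K n S *
      (\<Sum>k\<le>n - S n. of_nat ((n - S n) choose k) * x ^ (n - S n - k) * K (Suc k) (Suc n)))"
    by (rule sum.cong) (simp_all only: inner)
  finally show ?thesis
    by (simp add: path_sum_def sum.distrib sum_distrib_left)
qed

section \<open>Product moments of tails as path sums\<close>

context crm
begin

definition tail_moment :: "(nat \<Rightarrow> real) \<Rightarrow> (real \<Rightarrow> real) \<Rightarrow> nat \<Rightarrow> nat \<Rightarrow> ennreal" where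
  "tail_moment T h m j = (\<integral>\<^sup>+p. indicator {T j<..} (fst p) * ennreal (snd p) ^ m
      * enn_exp_neg (ennreal (h (fst p)) * ennreal (snd p)) \<partial>R)"

text \<open>The factor with the largest time is expanded first: its x lets index n + 1 wait, and its
  mass becomes an integral over one jump by \<open>palm\<close>. In this order every jump lies
  beyond all remaining times, so the inner expectation is again of the claimed form.\<close>

lemma tail_product_moment:
  assumes h: "h \<in> borel_measurable borel" "\<And>u. 0 \<le> h u" "\<And>u. T 1 < u \<Longrightarrow> e \<le> h u" "0 < e"
    and T: "\<And>i j. 1 \<le> i \<Longrightarrow> i \<le> j \<Longrightarrow> j \<le> n \<Longrightarrow> T i \<le> T j" and x: "x < \<top>"
  shows "(\<integral>\<^sup>+M. (\<Prod>i\<in>{1..n}. emeasure M {T i<..} + x) * enn_exp_neg (\<integral>\<^sup>+u. ennreal (h u) \<partial>M) \<partial>L)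
    = enn_exp_neg (psi h) * path_sum (tail_moment T h) n x"
  using T x
proof (induction n arbitrary: x)
  case 0
  then show ?case unfolding psi_def using laplace[OF h(1,2)] by (simp add: path_sum_0)
next
  case (Suc n)
  note [measurable] = h(1)
  let ?E = "\<lambda>M. enn_exp_neg (\<integral>\<^sup>+u. ennreal (h u) \<partial>M)"
  let ?K = "tail_moment T h"
  let ?e = "\<lambda>p. enn_exp_neg (ennreal (h (fst p)) * ennreal (snd p))"
  have IH: "(\<integral>\<^sup>+M. (\<Prod>i\<in>{1..n}. emeasure M {T i<..} + y) * ?E M \<partial>L) = enn_exp_neg (psi h) * path_sum ?K n y"
    if "y < \<top>" for y
    using Suc.prems that by (intro Suc.IH) auto
  have "(\<integral>\<^sup>+M. (\<Prod>i\<in>{1..Suc n}. emeasure M {T i<..} + x) * ?E M \<partial>L)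
    = (\<integral>\<^sup>+M. x * ((\<Prod>i\<in>{1..n}. emeasure M {T i<..} + x) * ?E M)
       + emeasure M {T (Suc n)<..} * (\<Prod>i\<in>{1..n}. emeasure M {T i<..} + x) * ?E M \<partial>L)"
    by (simp add: algebra_simps)
  also have "\<dots> = x * (\<integral>\<^sup>+M. (\<Prod>i\<in>{1..n}. emeasure M {T i<..} + x) * ?E M \<partial>L)
       + (\<integral>\<^sup>+M. emeasure M {T (Suc n)<..} * (\<Prod>i\<in>{1..n}. emeasure M {T i<..} + x) * ?E M \<partial>L)"
    by (subst nn_integral_add) (simp_all add: nn_integral_cmult)
  also have "(\<integral>\<^sup>+M. emeasure M {T (Suc n)<..} * (\<Prod>i\<in>{1..n}. emeasure M {T i<..} + x) * ?E M \<partial>L)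
    = (\<integral>\<^sup>+p. indicator {T (Suc n)<..} (fst p) * ennreal (snd p) * ?e p *
        (\<integral>\<^sup>+M. (\<Prod>i\<in>{1..n}. emeasure M {T i<..} + (x + ennreal (snd p) * indicator {T i<..} (fst p))) * ?E M \<partial>L) \<partial>R)"
    \<comment> \<open>The tail beyond T 1 contains all the others, and the lower bound e on h holds
      there.\<close>
    by (rule palm[where D = "{T 1<..}" and e = e]) (use Suc.prems h in \<open>auto intro: le_less_trans\<close>)
  also have "\<dots> = (\<integral>\<^sup>+p. indicator {T (Suc n)<..} (fst p) * ennreal (snd p) * ?e p *
        (enn_exp_neg (psi h) * path_sum ?K n (x + ennreal (snd p))) \<partial>R)"
  proof (rule nn_integral_cong)
    fix p
    show "indicator {T (Suc n)<..} (fst p) * ennreal (snd p) * ?e p *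
        (\<integral>\<^sup>+M. (\<Prod>i\<in>{1..n}. emeasure M {T i<..} + (x + ennreal (snd p) * indicator {T i<..} (fst p))) * ?E M \<partial>L)
      = indicator {T (Suc n)<..} (fst p) * ennreal (snd p) * ?e p *
        (enn_exp_neg (psi h) * path_sum ?K n (x + ennreal (snd p)))"
    proof (cases "T (Suc n) < fst p")
      case True
      have "(\<integral>\<^sup>+M. (\<Prod>i\<in>{1..n}. emeasure M {T i<..} + (x + ennreal (snd p) * indicator {T i<..} (fst p))) * ?E M \<partial>L)
        = (\<integral>\<^sup>+M. (\<Prod>i\<in>{1..n}. emeasure M {T i<..} + (x + ennreal (snd p))) * ?E M \<partial>L)"
      proof (intro nn_integral_cong arg_cong2[where f = "(*)"] prod.cong refl)
        fix M i assume i: "i \<in> {1..n}"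
        have "T i < fst p" using Suc.prems(1)[of i "Suc n"] i True by auto
        then show "emeasure M {T i<..} + (x + ennreal (snd p) * indicator {T i<..} (fst p))
          = emeasure M {T i<..} + (x + ennreal (snd p))" by simp
      qed
      with IH[of "x + ennreal (snd p)"] Suc.prems(2) show ?thesis by (simp add: less_top)
    qed simp
  qed
  also have "\<dots> = enn_exp_neg (psi h) * (\<integral>\<^sup>+p. (\<Sum>S\<in>partial_paths n. path_weight ?K n S *
      (\<Sum>k\<le>n - S n. of_nat ((n - S n) choose k) * x ^ (n - S n - k) *
        (indicator {T (Suc n)<..} (fst p) * ennreal (snd p) ^ Suc k * ?e p))) \<partial>R)"
  proof -
    \<comment> \<open>Binomial expansion of (x + z)^{n - S n}; the factor z already present raises
      each power of z to k + 1.\<close>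
    have "indicator {T (Suc n)<..} (fst p) * ennreal (snd p) * ?e p * (enn_exp_neg (psi h) * path_sum ?K n (x + ennreal (snd p)))
      = enn_exp_neg (psi h) * (\<Sum>S\<in>partial_paths n. path_weight ?K n S *
      (\<Sum>k\<le>n - S n. of_nat ((n - S n) choose k) * x ^ (n - S n - k) *
        (indicator {T (Suc n)<..} (fst p) * ennreal (snd p) ^ Suc k * ?e p)))" for p
      unfolding path_sum_def add.commute[of x] binomial_ring
      by (simp add: sum_distrib_left sum_distrib_right mult_ac)
    then show ?thesis
      by (simp only:) (rule nn_integral_cmult, measurable)
  qed
  also have "(\<integral>\<^sup>+p. (\<Sum>S\<in>partial_paths n. path_weight ?K n S *
      (\<Sum>k\<le>n - S n. of_nat ((n - S n) choose k) * x ^ (n - S n - k) *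
        (indicator {T (Suc n)<..} (fst p) * ennreal (snd p) ^ Suc k * ?e p))) \<partial>R)
    = (\<Sum>S\<in>partial_paths n. path_weight ?K n S *
      (\<Sum>k\<le>n - S n. of_nat ((n - S n) choose k) * x ^ (n - S n - k) * ?K (Suc k) (Suc n)))"
    unfolding tail_moment_def
    by (subst nn_integral_sum, measurable, intro sum.cong refl, subst nn_integral_cmult, measurable,
      intro arg_cong2[where f = "(*)"] refl, subst nn_integral_sum, measurable, intro sum.cong refl
      nn_integral_cmult, measurable)
  finally show ?case
    by (simp only: IH[OF Suc.prems(2)] path_sum_Suc distrib_left mult.left_commute[of x])
qed

end

section \<open>The intensity measure\<close>

lemma ennreal_divide_self_le_1: "x / x \<le> (1 :: ennreal)"
  by (cases "x = 0 \<or> x = \<top>") (auto simp: divide_ennreal_def[of \<top>] ennreal_divide_self less_top[symmetric])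

lemma ennreal_divide_mult_divide_self:
  fixes a b :: ennreal
  assumes "a \<noteq> 0" "a \<noteq> \<top>" "b \<noteq> 0" "b \<noteq> \<top>"
  shows "b / a * (a / b) = 1"
proof -
  have "b / a * (a / b) = (b / b) * (a / a)" by (simp add: divide_ennreal_def mult_ac)
  with assms show ?thesis by (simp add: ennreal_divide_self less_top)
qed

lemma measurable_nn_integral_kernel:
  assumes sets: "\<And>u. u \<in> space M \<Longrightarrow> sets (\<rho> u) = sets N"
    and kernel: "\<And>A. A \<in> sets N \<Longrightarrow> (\<lambda>u. emeasure (\<rho> u) A) \<in> borel_measurable M"
    and f: "f \<in> borel_measurable N"
  shows "(\<lambda>u. \<integral>\<^sup>+z. f z \<partial>\<rho> u) \<in> borel_measurable M"
  using f
proof (induction rule: borel_measurable_induct)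
  case (cong f g)
  have "(\<lambda>u. \<integral>\<^sup>+z. f z \<partial>\<rho> u) \<in> borel_measurable M \<longleftrightarrow> (\<lambda>u. \<integral>\<^sup>+z. g z \<partial>\<rho> u) \<in> borel_measurable M"
    using cong sets_eq_imp_space_eq[OF sets] by (intro measurable_cong nn_integral_cong) auto
  with cong show ?case by simp
next
  case (set A)
  have "(\<lambda>u. \<integral>\<^sup>+z. indicator A z \<partial>\<rho> u) \<in> borel_measurable M
    \<longleftrightarrow> (\<lambda>u. emeasure (\<rho> u) A) \<in> borel_measurable M"
    using set sets by (intro measurable_cong) (simp add: nn_integral_indicator)
  with set kernel show ?case by simp
next
  case (mult v c)
  have "(\<lambda>u. \<integral>\<^sup>+z. c * v z \<partial>\<rho> u) \<in> borel_measurable M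
    \<longleftrightarrow> (\<lambda>u. c * (\<integral>\<^sup>+z. v z \<partial>\<rho> u)) \<in> borel_measurable M"
    using mult sets by (intro measurable_cong nn_integral_cmult) (simp cong: measurable_cong_sets)
  with mult show ?case by simp
next
  case (add v w)
  have "(\<lambda>u. \<integral>\<^sup>+z. w z + v z \<partial>\<rho> u) \<in> borel_measurable M
    \<longleftrightarrow> (\<lambda>u. (\<integral>\<^sup>+z. w z \<partial>\<rho> u) + (\<integral>\<^sup>+z. v z \<partial>\<rho> u)) \<in> borel_measurable M"
    using add sets by (intro measurable_cong nn_integral_add) (simp_all cong: measurable_cong_sets)
  with add show ?case by simp
next
  case (seq V)
  have "(\<lambda>u. \<integral>\<^sup>+z. (SUP i. V i) z \<partial>\<rho> u) \<in> borel_measurable M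
    \<longleftrightarrow> (\<lambda>u. SUP i. \<integral>\<^sup>+z. V i z \<partial>\<rho> u) \<in> borel_measurable M"
    unfolding SUP_apply using seq sets
    by (intro measurable_cong nn_integral_monotone_convergence_SUP) (simp_all cong: measurable_cong_sets)
  with seq show ?case by simp
qed

text \<open>The kernel \<^term>\<open>\<rho>\<close> is infinite in general; after weighting by \<^term>\<open>\<lambda>z::real. min z 1\<close> it is
  finite for almost every \<^term>\<open>u\<close>, so the library construction for sub-probability kernels applies.\<close>

lemma kernel_measure_exists:
  fixes \<eta> :: "real measure" and \<rho> :: "real \<Rightarrow> real measure"
  assumes eta_sets: "sets \<eta> = sets borel" and eta_supp: "emeasure \<eta> {..0} = 0"
    and rho_sets: "\<forall>u>0. sets (\<rho> u) = sets borel \<and> emeasure (\<rho> u) {..0} = 0"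
    and rho_kernel: "\<forall>A \<in> sets borel.
          (\<lambda>u. emeasure (\<rho> u) A) \<in> borel_measurable (restrict_space borel {0<..})"
    and levy: "\<forall>B \<in> sets borel. bounded B \<and> B \<subseteq> {0<..} \<longrightarrow>
          (\<integral>\<^sup>+ u \<in> B. (\<integral>\<^sup>+ z. ennreal (min z 1) \<partial>\<rho> u) \<partial>\<eta>) < \<infinity>"
  obtains R :: "(real \<times> real) measure" where "sets R = sets (borel \<Otimes>\<^sub>M borel)"
    "\<And>F. F \<in> borel_measurable (borel \<Otimes>\<^sub>M borel) \<Longrightarrow> (\<integral>\<^sup>+p. F p \<partial>R) = (\<integral>\<^sup>+u. \<integral>\<^sup>+z. F (u, z) \<partial>\<rho> u \<partial>\<eta>)"
proof -
  note [measurable_cong] = eta_sets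
  \<comment> \<open>The kernel is controlled only at positive u, so the indicator extends
    measurability to the whole line.\<close>
  have meas: "(\<lambda>u. (\<integral>\<^sup>+z. f z \<partial>\<rho> u) * indicator {0<..} u) \<in> borel_measurable borel"
    if "f \<in> borel_measurable borel" for f :: "real \<Rightarrow> ennreal"
    using measurable_nn_integral_kernel[of "restrict_space borel {0<..}" \<rho> borel f] rho_sets rho_kernel that
    by (subst borel_measurable_restrict_space_iff_ennreal[symmetric]) (auto simp: space_restrict_space)
  define w where "w u = (\<integral>\<^sup>+z. ennreal (min z 1) \<partial>\<rho> u) * indicator {0<..} u" for u
  have [measurable]: "w \<in> borel_measurable borel" unfolding w_def by (rule meas) measurable
  define G where "G = {u. 0 < u \<and> w u < \<top>}"
  have [measurable]: "G \<in> sets borel" unfolding G_def by measurable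
  have rho[measurable_cong]: "sets (\<rho> u) = sets borel" and rho0: "emeasure (\<rho> u) {..0} = 0" if "u \<in> G" for u
    using rho_sets that by (auto simp: G_def)
  have AE_pos: "AE u in \<eta>. 0 < u"
    using eta_supp eta_sets by (intro AE_I[where N = "{..0}"]) auto
  have AE_G: "AE u in \<eta>. u \<in> G"
  proof -
    \<comment> \<open>The Levy condition speaks of bounded sets only; the intervals (0, k) exhaust
      the half line.\<close>
    have "AE u in \<eta>. w u * indicator {0<..<real k} u \<noteq> \<infinity>" for k
    proof (rule nn_integral_PInf_AE)
      have "(\<integral>\<^sup>+ u \<in> {0<..<real k}. (\<integral>\<^sup>+ z. ennreal (min z 1) \<partial>\<rho> u) \<partial>\<eta>) < \<infinity>"
        by (rule levy[rule_format]) (auto intro: bounded_subset[OF bounded_closed_interval[of 0 "real k"]])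
      also have "(\<integral>\<^sup>+ u \<in> {0<..<real k}. (\<integral>\<^sup>+ z. ennreal (min z 1) \<partial>\<rho> u) \<partial>\<eta>) = (\<integral>\<^sup>+ u \<in> {0<..<real k}. w u \<partial>\<eta>)"
        by (intro nn_integral_cong) (auto simp: w_def indicator_def)
      finally show "(\<integral>\<^sup>+ u \<in> {0<..<real k}. w u \<partial>\<eta>) \<noteq> \<infinity>" by simp
    qed measurable
    then have "AE u in \<eta>. \<forall>k. w u * indicator {0<..<real k} u \<noteq> \<infinity>"
      by (simp add: AE_all_countable)
    with AE_pos show ?thesis
    proof eventually_elim
      case (elim u)
      obtain k where "u < real k" using reals_Archimedean2 by blast
      with elim show ?case by (auto simp: G_def less_top[symmetric] dest!: spec[of _ k])
    qed
  qed
  \<comment> \<open>Division by 1 + w u brings the total mass to w u / (1 + w u), which is at most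
    1; exceptional u receive the zero measure, and they form a null set for
    \<open>\<eta>\<close>.\<close>
  define k where "k u = (if u \<in> G then density (\<rho> u) (\<lambda>z. ennreal (min z 1) / (1 + w u)) else null_measure borel)" for u
  have kernel: "k \<in> measurable borel (subprob_algebra borel)"
  proof (rule measurable_subprob_algebra)
    fix u :: real
    show sets_k: "sets (k u) = sets borel"
      by (auto simp: k_def rho)
    show "subprob_space (k u)"
    proof
      show "emeasure (k u) (space (k u)) \<le> 1"
      proof (cases "u \<in> G")
        case True
        note [measurable_cong] = rho[OF True]
        have "emeasure (k u) (space (k u)) = (\<integral>\<^sup>+z. ennreal (min z 1) / (1 + w u) \<partial>\<rho> u)"
          using True by (simp add: k_def emeasure_density cong: nn_integral_cong)
        also have "\<dots> = w u / (1 + w u)"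
          using True by (subst nn_integral_divide) (auto simp: w_def G_def)
        also have "\<dots> \<le> (1 + w u) / (1 + w u)"
          by (intro divide_right_mono_ennreal) simp
        also have "\<dots> \<le> 1"
          by (rule ennreal_divide_self_le_1)
        finally show ?thesis .
      qed (simp add: k_def)
      show "space (k u) \<noteq> {}" using sets_eq_imp_space_eq[OF sets_k] by simp
    qed
  next
    fix A :: "real set" assume A[measurable]: "A \<in> sets borel"
    have "emeasure (k u) A = indicator G u * (((\<integral>\<^sup>+z. ennreal (min z 1) * indicator A z \<partial>\<rho> u) * indicator {0<..} u) / (1 + w u))" for u
    proof (cases "u \<in> G")
      case True
      note [measurable_cong] = rho[OF True]
      have "emeasure (k u) A = (\<integral>\<^sup>+z. (ennreal (min z 1) * indicator A z) / (1 + w u) \<partial>\<rho> u)"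
        using True A rho[OF True] by (simp add: k_def emeasure_density ennreal_times_divide mult.commute)
      also have "\<dots> = (\<integral>\<^sup>+z. ennreal (min z 1) * indicator A z \<partial>\<rho> u) / (1 + w u)"
        by (intro nn_integral_divide) measurable
      finally show ?thesis using True by (simp add: G_def)
    qed (simp add: k_def)
    moreover have [measurable]: "(\<lambda>u. (\<integral>\<^sup>+z. ennreal (min z 1) * indicator A z \<partial>\<rho> u) * indicator {0<..} u) \<in> borel_measurable borel"
      by (rule meas) measurable
    have "(\<lambda>u. indicator G u * (((\<integral>\<^sup>+z. ennreal (min z 1) * indicator A z \<partial>\<rho> u) * indicator {0<..} u) / (1 + w u))) \<in> borel_measurable borel"
      by measurable
    ultimately show "(\<lambda>u. emeasure (k u) A) \<in> borel_measurable borel" by simp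
  qed
  define K where "K = (\<lambda>u. distr (k u) (borel \<Otimes>\<^sub>M borel) (Pair u))"
  have K: "K \<in> measurable \<eta> (subprob_algebra (borel \<Otimes>\<^sub>M borel))"
    unfolding K_def using kernel by (intro measurable_distr2[where M = borel]) (auto cong: measurable_cong_sets)
  \<comment> \<open>The reciprocal of the weight used in k; it is a genuine inverse almost
    everywhere because jump sizes are almost surely positive.\<close>
  define W where "W p = (1 + w (fst p)) / ennreal (min (snd p) 1)" for p
  have [measurable]: "W \<in> borel_measurable (borel \<Otimes>\<^sub>M borel)" unfolding W_def by measurable
  have sets_bind: "sets (\<eta> \<bind> K) = sets (borel \<Otimes>\<^sub>M borel)"
    using K eta_sets by (intro sets_bind) (auto simp: sets_kernel dest: sets_eq_imp_space_eq)
  note [measurable_cong] = sets_bind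
  show ?thesis
  proof (rule that)
    show "sets (density (\<eta> \<bind> K) W) = sets (borel \<Otimes>\<^sub>M borel)" by (simp add: sets_bind)
    fix F :: "real \<times> real \<Rightarrow> ennreal" assume [measurable]: "F \<in> borel_measurable (borel \<Otimes>\<^sub>M borel)"
    have "(\<integral>\<^sup>+p. F p \<partial>density (\<eta> \<bind> K) W) = (\<integral>\<^sup>+p. W p * F p \<partial>(\<eta> \<bind> K))"
      by (rule nn_integral_density) measurable
    also have "\<dots> = (\<integral>\<^sup>+u. \<integral>\<^sup>+p. W p * F p \<partial>K u \<partial>\<eta>)"
      by (rule nn_integral_bind[OF _ K]) measurable
    also have "\<dots> = (\<integral>\<^sup>+u. \<integral>\<^sup>+z. F (u, z) \<partial>\<rho> u \<partial>\<eta>)"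
    proof (rule nn_integral_cong_AE, use AE_G in eventually_elim)
      fix u assume u: "u \<in> G"
      note [measurable_cong] = rho[OF u]
      have w: "1 + w u \<noteq> 0" "1 + w u \<noteq> \<top>" using u by (auto simp: G_def)
      have "sets (k u) = sets borel" by (auto simp: k_def rho)
      note [measurable_cong] = this
      have "(\<integral>\<^sup>+p. W p * F p \<partial>K u) = (\<integral>\<^sup>+z. W (u, z) * F (u, z) \<partial>k u)"
        unfolding K_def by (rule nn_integral_distr) measurable
      also have "\<dots> = (\<integral>\<^sup>+z. (ennreal (min z 1) / (1 + w u)) * (W (u, z) * F (u, z)) \<partial>\<rho> u)"
        using u unfolding k_def by (simp add: nn_integral_density)
      also have "\<dots> = (\<integral>\<^sup>+z. F (u, z) \<partial>\<rho> u)"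
      proof (rule nn_integral_cong_AE)
        have "AE z in \<rho> u. 0 < z"
          using rho0[OF u] rho[OF u] by (intro AE_I[where N = "{..0}"]) auto
        then show "AE z in \<rho> u. (ennreal (min z 1) / (1 + w u)) * (W (u, z) * F (u, z)) = F (u, z)"
        proof eventually_elim
          case (elim z)
          define b where "b = ennreal (min z 1)"
          have b: "b \<noteq> 0" "b \<noteq> \<top>" using elim by (auto simp: b_def)
          have "b / (1 + w u) * ((1 + w u) / b) = 1"
            using b w by (intro ennreal_divide_mult_divide_self)
          then show ?case by (simp add: W_def b_def[symmetric] mult.assoc[symmetric])
        qed
      qed
      finally show "(\<integral>\<^sup>+p. W p * F p \<partial>K u) = (\<integral>\<^sup>+z. F (u, z) \<partial>\<rho> u)" .
    qed
    finally show "(\<integral>\<^sup>+p. F p \<partial>density (\<eta> \<bind> K) W) = (\<integral>\<^sup>+u. \<integral>\<^sup>+z. F (u, z) \<partial>\<rho> u \<partial>\<eta>)" .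
  qed
qed

section \<open>Fixed atoms and the likelihood\<close>

lemma sets_add_atoms [simp]: "sets (add_atoms M J y Q) = sets borel"
  unfolding add_atoms_def using sets.sigma_sets_eq[of borel] by (subst sets_measure_of) auto

lemma emeasure_add_atoms:
  assumes M: "sets M = sets borel" and A: "A \<in> sets borel"
  shows "emeasure (add_atoms M J y Q) A = emeasure M A + (\<Sum>j\<in>J. ennreal (Q j) * indicator A (y j))"
proof (rule emeasure_measure_of[OF add_atoms_def])
  let ?\<mu> = "\<lambda>A. emeasure M A + (\<Sum>j\<in>J. ennreal (Q j) * indicator A (y j))"
  show "positive (sets (add_atoms M J y Q)) ?\<mu>" by (simp add: positive_def)
  show "countably_additive (sets (add_atoms M J y Q)) ?\<mu>"
  proof (rule countably_additiveI)
    fix A :: "nat \<Rightarrow> real set"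
    assume A: "range A \<subseteq> sets (add_atoms M J y Q)" "disjoint_family A"
    have "(\<Sum>i. emeasure M (A i)) = emeasure M (\<Union>i. A i)"
      using A M by (intro suminf_emeasure) auto
    moreover have "(\<Sum>i. ennreal (Q j) * indicator (A i) (y j)) = ennreal (Q j) * indicator (\<Union>i. A i) (y j)" for j
      using A by (simp add: suminf_indicator[symmetric])
    moreover have "(\<Sum>i. \<Sum>j\<in>J. ennreal (Q j) * indicator (A i) (y j)) = (\<Sum>j\<in>J. \<Sum>i. ennreal (Q j) * indicator (A i) (y j))"
      by (intro suminf_sum summableI)
    ultimately show "(\<Sum>i. ?\<mu> (A i)) = ?\<mu> (\<Union>i. A i)"
      by (subst suminf_add[symmetric]) simp_all
  qed
qed (use A in auto)

lemma nn_integral_add_atoms: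
  assumes M: "sets M = sets borel" and f: "f \<in> borel_measurable borel"
  shows "(\<integral>\<^sup>+u. f u \<partial>add_atoms M J y Q) = (\<integral>\<^sup>+u. f u \<partial>M) + (\<Sum>j\<in>J. ennreal (Q j) * f (y j))"
  using f
proof (induction rule: borel_measurable_induct)
  case (cong f g)
  then have "f = g" by auto
  with cong show ?case by simp
next
  case (set A)
  then show ?case using M by (simp add: emeasure_add_atoms nn_integral_indicator)
next
  case (mult u c)
  then show ?case using M
    by (simp add: nn_integral_cmult distrib_left sum_distrib_left mult_ac cong: measurable_cong_sets)
next
  case (add u v)
  then show ?case using M
    by (simp add: nn_integral_add sum.distrib distrib_left ac_simps cong: measurable_cong_sets)
next
  case (seq U)
  have inc: "incseq (\<lambda>i. ennreal (Q j) * U i (y j))" for j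
    using seq.hyps(3) by (auto simp: incseq_def le_fun_def intro: mult_left_mono)
  have "(\<integral>\<^sup>+u. (SUP i. U i) u \<partial>add_atoms M J y Q) = (SUP i. \<integral>\<^sup>+u. U i u \<partial>add_atoms M J y Q)"
    unfolding SUP_apply using seq by (intro nn_integral_monotone_convergence_SUP) (simp_all cong: measurable_cong_sets)
  also have "\<dots> = (SUP i. (\<integral>\<^sup>+u. U i u \<partial>M) + (\<Sum>j\<in>J. ennreal (Q j) * U i (y j)))"
    using seq by simp
  also have "\<dots> = (SUP i. \<integral>\<^sup>+u. U i u \<partial>M) + (SUP i. \<Sum>j\<in>J. ennreal (Q j) * U i (y j))"
    using seq.hyps(3) inc by (intro ennreal_SUP_add)
      (auto simp: incseq_def le_fun_def intro!: nn_integral_mono sum_mono mult_left_mono)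
  also have "(SUP i. \<integral>\<^sup>+u. U i u \<partial>M) = (\<integral>\<^sup>+u. (SUP i. U i) u \<partial>M)"
    unfolding SUP_apply using seq M
    by (intro nn_integral_monotone_convergence_SUP[symmetric]) (simp_all cong: measurable_cong_sets)
  also have "(SUP i. \<Sum>j\<in>J. ennreal (Q j) * U i (y j)) = (\<Sum>j\<in>J. ennreal (Q j) * (SUP i. U i) (y j))"
    unfolding SUP_apply SUP_mult_left_ennreal using inc by (intro ennreal_SUP_sum)
  finally show ?case .
qed

text \<open>The three-step experiment is specified by probabilities of rectangles only. The passage
  to product integrands treats one coordinate at a time, as a comparison of image measures, so no
  product measure has to be formed.\<close>

lemma nn_integral_prod_rectangles:
  assumes "finite J" and [measurable]: "\<And>j. j \<in> J \<Longrightarrow> X j \<in> measurable P (N j)"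
    and \<nu>: "\<And>j. j \<in> J \<Longrightarrow> sets (\<nu> j) = sets (N j)"
    and F: "\<And>j. j \<in> J \<Longrightarrow> F j \<in> borel_measurable (N j)"
    and rect: "\<And>A. (\<And>j. j \<in> J \<Longrightarrow> A j \<in> sets (N j)) \<Longrightarrow>
      emeasure P {\<omega> \<in> space P. \<forall>j\<in>J. X j \<omega> \<in> A j} = c * (\<Prod>j\<in>J. emeasure (\<nu> j) (A j))"
  shows "(\<integral>\<^sup>+\<omega>. (\<Prod>j\<in>J. F j (X j \<omega>)) \<partial>P) = c * (\<Prod>j\<in>J. \<integral>\<^sup>+x. F j x \<partial>\<nu> j)"
  using assms
proof (induction J arbitrary: P c)
  case empty
  from empty.prems(4)[of "\<lambda>_. {}"] show ?case by simp
next
  case (insert a J)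
  let ?c = "c * (\<Prod>j\<in>J. \<integral>\<^sup>+x. F j x \<partial>\<nu> j)"
  have X[measurable]: "X a \<in> measurable P (N a)" "\<And>j. j \<in> J \<Longrightarrow> X j \<in> measurable P (N j)"
    and F[measurable]: "F a \<in> borel_measurable (N a)" "\<And>j. j \<in> J \<Longrightarrow> F j \<in> borel_measurable (N j)"
    using insert.prems by auto
  define p where "p \<omega> = (\<Prod>j\<in>J. F j (X j \<omega>))" for \<omega>
  have [measurable]: "p \<in> borel_measurable P" unfolding p_def by measurable
  have "distr (density P p) (N a) (X a) = density (\<nu> a) (\<lambda>_. ?c)"
  proof (rule measure_eqI)
    show "sets (distr (density P p) (N a) (X a)) = sets (density (\<nu> a) (\<lambda>_. ?c))"
      using insert.prems by simp
    fix B assume "B \<in> sets (distr (density P p) (N a) (X a))"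
    then have B[measurable]: "B \<in> sets (N a)" by simp
    let ?B = "X a -` B \<inter> space P"
    have [measurable]: "?B \<in> sets P" by measurable
    \<comment> \<open>Restricting P to the event that coordinate a lies in B preserves the rectangle
      formula, with the mass of B moved into the constant; hence P and c vary in the
      induction.\<close>
    have "(\<integral>\<^sup>+\<omega>. (\<Prod>j\<in>J. F j (X j \<omega>)) \<partial>density P (indicator ?B))
      = (c * emeasure (\<nu> a) B) * (\<Prod>j\<in>J. \<integral>\<^sup>+x. F j x \<partial>\<nu> j)"
    proof (rule insert.IH)
      fix A assume A: "\<And>j. j \<in> J \<Longrightarrow> A j \<in> sets (N j)"
      note [measurable] = A
      have "emeasure (density P (indicator ?B)) {\<omega> \<in> space P. \<forall>j\<in>J. X j \<omega> \<in> A j}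
        = emeasure P (?B \<inter> {\<omega> \<in> space P. \<forall>j\<in>J. X j \<omega> \<in> A j})"
        using insert.hyps by (intro emeasure_restricted) auto
      also have "?B \<inter> {\<omega> \<in> space P. \<forall>j\<in>J. X j \<omega> \<in> A j} = {\<omega> \<in> space P. \<forall>j\<in>insert a J. X j \<omega> \<in> (A(a := B)) j}"
        using insert.hyps by auto
      also have "emeasure P \<dots> = c * (\<Prod>j\<in>insert a J. emeasure (\<nu> j) ((A(a := B)) j))"
        using A B by (intro insert.prems(4)) auto
      also have "\<dots> = c * emeasure (\<nu> a) B * (\<Prod>j\<in>J. emeasure (\<nu> j) (A j))"
        using insert.hyps by (auto simp: mult.assoc intro!: arg_cong2[where f = "(*)"] prod.cong)
      finally show "emeasure (density P (indicator ?B)) {\<omega> \<in> space (density P (indicator ?B)). \<forall>j\<in>J. X j \<omega> \<in> A j}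
        = c * emeasure (\<nu> a) B * (\<Prod>j\<in>J. emeasure (\<nu> j) (A j))" by simp
    qed (use insert.prems in auto)
    moreover have "(\<integral>\<^sup>+\<omega>. (\<Prod>j\<in>J. F j (X j \<omega>)) \<partial>density P (indicator ?B)) = (\<integral>\<^sup>+\<omega>. indicator ?B \<omega> * p \<omega> \<partial>P)"
      unfolding p_def[symmetric] by (rule nn_integral_density) measurable
    moreover have "emeasure (distr (density P p) (N a) (X a)) B = (\<integral>\<^sup>+\<omega>. p \<omega> * indicator ?B \<omega> \<partial>P)"
      by (simp add: emeasure_distr emeasure_density)
    ultimately show "emeasure (distr (density P p) (N a) (X a)) B = emeasure (density (\<nu> a) (\<lambda>_. ?c)) B"
      using insert.prems(2)[of a] by (simp add: emeasure_density_const mult_ac)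
  qed
  then have "(\<integral>\<^sup>+x. F a x \<partial>distr (density P p) (N a) (X a)) = (\<integral>\<^sup>+x. F a x \<partial>density (\<nu> a) (\<lambda>_. ?c))" by simp
  moreover have "F a \<in> borel_measurable (\<nu> a)"
    using insert.prems(2)[of a] by (simp cong: measurable_cong_sets)
  ultimately show ?case
    using insert.hyps by (simp add: nn_integral_distr nn_integral_density nn_integral_cmult nn_integral_multc p_def mult_ac)
qed

text \<open>Adds an event, later that a given path was drawn, and one coordinate of another type,
  later the random measure drawn in the third step.\<close>

lemma nn_integral_prod_rectangles':
  assumes J: "finite J" and X[measurable]: "\<And>j. j \<in> J \<Longrightarrow> X j \<in> measurable P (N j)"
    and \<nu>: "\<And>j. j \<in> J \<Longrightarrow> sets (\<nu> j) = sets (N j)"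
    and F[measurable]: "\<And>j. j \<in> J \<Longrightarrow> F j \<in> borel_measurable (N j)"
    and E[measurable]: "E \<in> sets P" and W[measurable]: "W \<in> measurable P K'" and K: "sets K = sets K'"
    and H[measurable]: "H \<in> borel_measurable K'"
    and rect: "\<And>A B. (\<And>j. j \<in> J \<Longrightarrow> A j \<in> sets (N j)) \<Longrightarrow> B \<in> sets K' \<Longrightarrow>
      emeasure P {\<omega> \<in> space P. \<omega> \<in> E \<and> (\<forall>j\<in>J. X j \<omega> \<in> A j) \<and> W \<omega> \<in> B}
      = c * (\<Prod>j\<in>J. emeasure (\<nu> j) (A j)) * emeasure K B"
  shows "(\<integral>\<^sup>+\<omega>. indicator E \<omega> * (\<Prod>j\<in>J. F j (X j \<omega>)) * H (W \<omega>) \<partial>P)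
    = c * (\<Prod>j\<in>J. \<integral>\<^sup>+x. F j x \<partial>\<nu> j) * (\<integral>\<^sup>+x. H x \<partial>K)"
proof -
  let ?c = "c * (\<Prod>j\<in>J. \<integral>\<^sup>+x. F j x \<partial>\<nu> j)"
  define p where "p \<omega> = indicator E \<omega> * (\<Prod>j\<in>J. F j (X j \<omega>))" for \<omega>
  have [measurable]: "p \<in> borel_measurable P" unfolding p_def by measurable
  have "distr (density P p) K' W = density K (\<lambda>_. ?c)"
  proof (rule measure_eqI)
    show "sets (distr (density P p) K' W) = sets (density K (\<lambda>_. ?c))" using K by simp
    fix B assume "B \<in> sets (distr (density P p) K' W)"
    then have B[measurable]: "B \<in> sets K'" by simp
    let ?B = "E \<inter> (W -` B \<inter> space P)"
    have [measurable]: "?B \<in> sets P" by measurable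
    have "(\<integral>\<^sup>+\<omega>. (\<Prod>j\<in>J. F j (X j \<omega>)) \<partial>density P (indicator ?B))
      = (c * emeasure K B) * (\<Prod>j\<in>J. \<integral>\<^sup>+x. F j x \<partial>\<nu> j)"
    proof (rule nn_integral_prod_rectangles[where N = N])
      fix A assume A: "\<And>j. j \<in> J \<Longrightarrow> A j \<in> sets (N j)"
      note [measurable] = A
      have "emeasure (density P (indicator ?B)) {\<omega> \<in> space P. \<forall>j\<in>J. X j \<omega> \<in> A j}
        = emeasure P (?B \<inter> {\<omega> \<in> space P. \<forall>j\<in>J. X j \<omega> \<in> A j})"
        using J by (intro emeasure_restricted) auto
      also have "?B \<inter> {\<omega> \<in> space P. \<forall>j\<in>J. X j \<omega> \<in> A j}
        = {\<omega> \<in> space P. \<omega> \<in> E \<and> (\<forall>j\<in>J. X j \<omega> \<in> A j) \<and> W \<omega> \<in> B}" by auto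
      finally show "emeasure (density P (indicator ?B)) {\<omega> \<in> space (density P (indicator ?B)). \<forall>j\<in>J. X j \<omega> \<in> A j}
        = c * emeasure K B * (\<Prod>j\<in>J. emeasure (\<nu> j) (A j))"
        using rect[OF A B] by (simp add: mult_ac)
    qed (use J X \<nu> F in auto)
    moreover have "(\<integral>\<^sup>+\<omega>. (\<Prod>j\<in>J. F j (X j \<omega>)) \<partial>density P (indicator ?B))
      = (\<integral>\<^sup>+\<omega>. indicator ?B \<omega> * (\<Prod>j\<in>J. F j (X j \<omega>)) \<partial>P)"
      by (rule nn_integral_density) measurable
    moreover have "emeasure (distr (density P p) K' W) B = (\<integral>\<^sup>+\<omega>. p \<omega> * indicator (W -` B \<inter> space P) \<omega> \<partial>P)"
      by (simp add: emeasure_distr emeasure_density)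
    moreover have "(\<integral>\<^sup>+\<omega>. p \<omega> * indicator (W -` B \<inter> space P) \<omega> \<partial>P) = (\<integral>\<^sup>+\<omega>. indicator ?B \<omega> * (\<Prod>j\<in>J. F j (X j \<omega>)) \<partial>P)"
      unfolding p_def by (intro nn_integral_cong) (auto simp: indicator_def)
    ultimately show "emeasure (distr (density P p) K' W) B = emeasure (density K (\<lambda>_. ?c)) B"
      using K by (simp add: emeasure_density_const mult_ac)
  qed
  then have "(\<integral>\<^sup>+x. H x \<partial>distr (density P p) K' W) = (\<integral>\<^sup>+x. H x \<partial>density K (\<lambda>_. ?c))" by simp
  moreover have "H \<in> borel_measurable K" using K by (simp cong: measurable_cong_sets)
  ultimately show ?thesis
    by (simp add: nn_integral_distr nn_integral_density nn_integral_cmult nn_integral_multc p_def mult_ac)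
qed

section \<open>The cumulative exposure\<close>

lemma gN_eq_sum:
  "gN N T \<tau> u = (\<Sum>i=1..N. measure lborel ({0..\<tau>} \<inter> {..T i} \<inter> {..<u}))"
proof -
  have fin: "emeasure lborel ({0..\<tau>} \<inter> {..T i} \<inter> {..<u}) < \<infinity>" for i
  proof -
    have "emeasure lborel ({0..\<tau>} \<inter> {..T i} \<inter> {..<u}) \<le> emeasure lborel {0..\<tau>}"
      by (intro emeasure_mono) auto
    also have "\<dots> < \<infinity>" by (simp add: emeasure_lborel_Icc_eq)
    finally show ?thesis .
  qed
  have "gN N T \<tau> u = (LINT t|lborel. (\<Sum>i=1..N. indicator ({0..\<tau>} \<inter> {..T i} \<inter> {..<u}) t))"
    unfolding gN_def set_lebesgue_integral_def real_scaleR_def sum_distrib_left sum_distrib_right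
    by (intro Bochner_Integration.integral_cong refl sum.cong) (auto simp: indicator_def)
  also have "\<dots> = (\<Sum>i=1..N. measure lborel ({0..\<tau>} \<inter> {..T i} \<inter> {..<u}))"
    using fin by (subst Bochner_Integration.integral_sum) auto
  finally show ?thesis .
qed

lemma gN_nonneg: "0 \<le> gN N T \<tau> u"
  unfolding gN_eq_sum by (intro sum_nonneg) simp

text \<open>Item i alone is at risk throughout [0, T i], and every such time lies below u.\<close>

lemma gN_ge:
  assumes "1 \<le> i" "i \<le> N" "0 \<le> T i" "T i \<le> \<tau>" "T i < u"
  shows "T i \<le> gN N T \<tau> u"
proof -
  have "{0..\<tau>} \<inter> {..T i} \<inter> {..<u} = {0..T i}" using assms by auto
  then have "T i = measure lborel ({0..\<tau>} \<inter> {..T i} \<inter> {..<u})" using assms by simp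
  also have "\<dots> \<le> gN N T \<tau> u"
    unfolding gN_eq_sum using assms by (intro member_le_sum) auto
  finally show ?thesis .
qed

lemma measurable_gN [measurable]: "gN N T \<tau> \<in> borel_measurable borel"
proof -
  have "(\<lambda>u. LINT t|lborel. indicator {0..\<tau>} t *\<^sub>R ((\<Sum>i=1..N. if t \<le> T i then 1 else 0) * (if t < u then 1 else 0 :: real))) \<in> borel_measurable borel"
    by measurable
  also have "(\<lambda>u. LINT t|lborel. indicator {0..\<tau>} t *\<^sub>R ((\<Sum>i=1..N. if t \<le> T i then 1 else 0) * (if t < u then 1 else 0 :: real))) = gN N T \<tau>"
    unfolding gN_def set_lebesgue_integral_def
    by (intro ext Bochner_Integration.integral_cong) (auto simp: indicator_def)
  finally show ?thesis .
qed

lemma ennreal_mult_divide_cancel_left: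
  fixes a x y :: ennreal
  assumes "a \<noteq> 0" "a \<noteq> \<top>" "y \<noteq> \<top>"
  shows "(a * x) / (a * y) = x / y"
proof -
  have "(a * x) / (a * y) = (a * inverse a) * (x * inverse y)"
    using assms by (simp add: divide_ennreal_def ennreal_inverse_mult less_top mult_ac)
  also have "a * inverse a = 1"
    using assms by (simp add: ennreal_divide_self less_top flip: divide_ennreal_def)
  finally show ?thesis by (simp add: divide_ennreal_def)
qed

section \<open>The posterior law\<close>

theorem theorem2p1:
  fixes \<eta> :: "real measure" and \<rho> :: "real \<Rightarrow> real measure"
    and L\<mu> :: "real measure measure"
    and N n :: nat and T :: "nat \<Rightarrow> real" and \<tau> :: real
  assumes eta_sets: "sets \<eta> = sets borel" and eta_supp: "emeasure \<eta> {..0} = 0"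
    and rho_sets: "\<forall>u>0. sets (\<rho> u) = sets borel \<and> emeasure (\<rho> u) {..0} = 0"
    and rho_kernel: "\<forall>A \<in> sets borel.
          (\<lambda>u. emeasure (\<rho> u) A) \<in> borel_measurable (restrict_space borel {0<..})"
    and levy: "\<forall>B \<in> sets borel. bounded B \<and> B \<subseteq> {0<..} \<longrightarrow>
          (\<integral>\<^sup>+ u \<in> B. (\<integral>\<^sup>+ z. ennreal (min z 1) \<partial>\<rho> u) \<partial>\<eta>) < \<infinity>"
    and prior: "is_crm_law L\<mu> \<rho> \<eta>"
    and nN: "n \<le> N" and tau_pos: "0 < \<tau>"
    and T_pos: "\<forall>i\<in>{1..N}. 0 < T i"
    and T_incr: "\<forall>i. 1 \<le> i \<and> i < n \<longrightarrow> T i < T (i + 1)"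
    and T_last: "1 \<le> n \<longrightarrow> T n < \<tau>"
    and T_cens: "\<forall>i\<in>{n<..N}. T i = \<tau>"
    and kappa_fin: "\<forall>i\<in>{1..n}. \<forall>u>0. kappa (gN N T \<tau>) \<rho> i u < \<infinity>"
    and post_def: "0 < (\<integral>\<^sup>+ M. likelihood N n T \<tau> M \<partial>L\<mu>)"
                  "(\<integral>\<^sup>+ M. likelihood N n T \<tau> M \<partial>L\<mu>) < \<infinity>"
    and P: "prob_space P"
    and Lstar: "is_crm_law Lstar (\<lambda>u. density (\<rho> u) (\<lambda>z. ennreal (exp (- gN N T \<tau> u * z)))) \<eta>"
    and Sv_meas: "Sv \<in> measurable P (count_space UNIV)"
    and YQ_meas: "\<forall>j. (\<lambda>\<omega>. (Y \<omega> j, Q \<omega> j)) \<in> borel_measurable P"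
    and Mstar_meas: "Mstar \<in> measurable P meas_space"
    and three_step: "\<forall>S \<in> Spaths n. \<forall>A B. (\<forall>j\<in>jumps n S. A j \<in> sets (borel \<Otimes>\<^sub>M borel))
          \<and> B \<in> sets meas_space \<longrightarrow>
          emeasure P {\<omega> \<in> space P. Sv \<omega> = S \<and> (\<forall>j\<in>jumps n S. (Y \<omega> j, Q \<omega> j) \<in> A j)
                                    \<and> Mstar \<omega> \<in> B}
          = Zprob n T (gN N T \<tau>) \<rho> \<eta> S
            * (\<Prod>j\<in>jumps n S. pair_law n T (gN N T \<tau>) \<rho> \<eta> S j (A j))
            * emeasure Lstar B"
  shows "distr P meas_space (\<lambda>\<omega>. add_atoms (Mstar \<omega>) (jumps n (Sv \<omega>)) (Y \<omega>) (Q \<omega>))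
         = posterior L\<mu> (likelihood N n T \<tau>)"
proof -
  define g where "g = gN N T \<tau>"
  have g_meas[measurable]: "g \<in> borel_measurable borel" unfolding g_def by measurable
  have g_nn: "0 \<le> g u" for u by (simp add: g_def gN_nonneg)
  have sets_Lstar: "sets Lstar = sets meas_space" and prob_Lstar: "prob_space Lstar"
    using Lstar by (auto simp: is_crm_law_def)
  obtain R where sets_R: "sets R = sets (borel \<Otimes>\<^sub>M borel)"
    and R: "\<And>F. F \<in> borel_measurable (borel \<Otimes>\<^sub>M borel) \<Longrightarrow> (\<integral>\<^sup>+p. F p \<partial>R) = (\<integral>\<^sup>+u. \<integral>\<^sup>+z. F (u, z) \<partial>\<rho> u \<partial>\<eta>)"
    using kernel_measure_exists[OF eta_sets eta_supp rho_sets rho_kernel levy] by blast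
  have AE_u: "AE u in \<eta>. 0 < u"
    using eta_supp eta_sets by (intro AE_I[where N = "{..0}"]) auto
  have AE_z: "AE z in \<rho> u. 0 < z" if "0 < u" for u
    using rho_sets that by (intro AE_I[where N = "{..0}"]) auto
  \<comment> \<open>Integrands need to be compared only at positive locations and jump sizes, since
    \<open>\<eta>\<close> and the kernel charge nothing else.\<close>
  have R_eq: "(\<integral>\<^sup>+p. F p \<partial>R) = (\<integral>\<^sup>+u. G u \<partial>\<eta>)"
    if "F \<in> borel_measurable (borel \<Otimes>\<^sub>M borel)"
      and "\<And>u. 0 < u \<Longrightarrow> G u = (\<integral>\<^sup>+z. F' u z \<partial>\<rho> u)"
      and "\<And>u z. 0 < u \<Longrightarrow> 0 < z \<Longrightarrow> F (u, z) = F' u z" for F G F'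
    unfolding R[OF that(1)]
  proof (rule nn_integral_cong_AE, use AE_u in eventually_elim)
    fix u :: real assume u: "0 < u"
    show "(\<integral>\<^sup>+z. F (u, z) \<partial>\<rho> u) = G u"
      unfolding that(2)[OF u] using AE_z[OF u]
      by (intro nn_integral_cong_AE) (auto elim!: eventually_mono simp: that(3)[OF u])
  qed
  have e_pos: "enn_exp_neg (ennreal a * ennreal z) = ennreal (exp (- a * z))" if "0 \<le> a" "0 < z" for a z
    using that by (simp add: enn_exp_neg_ennreal flip: ennreal_mult)
  have e_pos': "1 - enn_exp_neg (ennreal a * ennreal z) = ennreal (1 - exp (- a * z))" if "0 \<le> a" "0 < z" for a z
    using that ennreal_minus[of "exp (- a * z)" 1] by (simp add: e_pos)
  have rho_cong: "sets (\<rho> u) = sets borel" if "0 < u" for u using rho_sets that by simp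
  interpret crm L\<mu> R
  proof (rule crm.intro)
    show "prob_space L\<mu>" "sets L\<mu> = sets meas_space" using prior by (auto simp: is_crm_law_def)
    fix h :: "real \<Rightarrow> real" assume h[measurable]: "h \<in> borel_measurable borel" and nn: "\<And>u. 0 \<le> h u"
    have "(\<integral>\<^sup>+M. enn_exp_neg (\<integral>\<^sup>+u. ennreal (h u) \<partial>M) \<partial>L\<mu>)
      = enn_exp_neg (\<integral>\<^sup>+ u. (\<integral>\<^sup>+ z. ennreal (1 - exp (- h u * z)) \<partial>\<rho> u) \<partial>\<eta>)"
      using prior h nn unfolding is_crm_law_def by blast
    also have "(\<integral>\<^sup>+ u. (\<integral>\<^sup>+ z. ennreal (1 - exp (- h u * z)) \<partial>\<rho> u) \<partial>\<eta>)
      = (\<integral>\<^sup>+p. 1 - enn_exp_neg (ennreal (h (fst p)) * ennreal (snd p)) \<partial>R)"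
      by (rule R_eq[symmetric]) (simp_all add: e_pos' nn)
    finally show "(\<integral>\<^sup>+M. enn_exp_neg (\<integral>\<^sup>+u. ennreal (h u) \<partial>M) \<partial>L\<mu>)
      = enn_exp_neg (\<integral>\<^sup>+p. 1 - enn_exp_neg (ennreal (h (fst p)) * ennreal (snd p)) \<partial>R)" .
  qed (rule sets_R)
  define e where "e f p = enn_exp_neg (ennreal (f (fst p)) * ennreal (snd p))" for f :: "real \<Rightarrow> real" and p :: "real \<times> real"
  have e_meas[measurable]: "e f \<in> borel_measurable (borel \<Otimes>\<^sub>M borel)" if [measurable]: "f \<in> borel_measurable borel" for f
    unfolding e_def by measurable
  \<comment> \<open>The Laplace exponent of the tilted random measure, and by \<open>psi_add\<close>
    also the increment of psi from g to g + f.\<close>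
  define \<Delta> where "\<Delta> f = (\<integral>\<^sup>+p. e g p * (1 - e f p) \<partial>R)" for f
  have Lstar_laplace: "(\<integral>\<^sup>+M. enn_exp_neg (\<integral>\<^sup>+u. ennreal (f u) \<partial>M) \<partial>Lstar) = enn_exp_neg (\<Delta> f)"
    if [measurable]: "f \<in> borel_measurable borel" and nn: "\<And>u. 0 \<le> f u" for f
  proof -
    have "(\<integral>\<^sup>+M. enn_exp_neg (\<integral>\<^sup>+u. ennreal (f u) \<partial>M) \<partial>Lstar)
      = enn_exp_neg (\<integral>\<^sup>+ u. (\<integral>\<^sup>+ z. ennreal (1 - exp (- f u * z)) \<partial>density (\<rho> u) (\<lambda>z. ennreal (exp (- g u * z)))) \<partial>\<eta>)"
      using Lstar that unfolding is_crm_law_def g_def[symmetric] by blast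
    also have "(\<integral>\<^sup>+ u. (\<integral>\<^sup>+ z. ennreal (1 - exp (- f u * z)) \<partial>density (\<rho> u) (\<lambda>z. ennreal (exp (- g u * z)))) \<partial>\<eta>) = \<Delta> f"
      unfolding \<Delta>_def
    proof (rule R_eq[symmetric])
      fix u :: real assume u: "0 < u"
      note [measurable_cong] = rho_cong[OF u]
      show "(\<integral>\<^sup>+ z. ennreal (1 - exp (- f u * z)) \<partial>density (\<rho> u) (\<lambda>z. ennreal (exp (- g u * z))))
        = (\<integral>\<^sup>+ z. ennreal (exp (- g u * z)) * ennreal (1 - exp (- f u * z)) \<partial>\<rho> u)"
        by (rule nn_integral_density) measurable
    next
      fix u z :: real assume "0 < z"
      then show "e g (u, z) * (1 - e f (u, z)) = ennreal (exp (- g u * z)) * ennreal (1 - exp (- f u * z))"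
        by (simp only: e_def fst_conv snd_conv e_pos'[OF nn \<open>0 < z\<close>] e_pos[OF g_nn \<open>0 < z\<close>])
    qed measurable
    finally show ?thesis .
  qed
  \<comment> \<open>The values \<open>c\<close> will be identified with the integrals occurring in
    \<open>phi\<close>, and \<open>t f\<close> are their analogues with g + f in the exponent; a
    path sum over \<open>t f\<close> then carries the Laplace transform of the fixed atoms.\<close>
  define t where "t f m j = tail_moment T (\<lambda>u. g u + f u) m j" for f m j
  define c where "c m j = tail_moment T g m j" for m j
  have e_add: "enn_exp_neg (ennreal (g u + f u) * z) = enn_exp_neg (ennreal (g u) * z) * enn_exp_neg (ennreal (f u) * z)"
    if "\<And>u. 0 \<le> f u" for f u z
    using that g_nn by (simp add: distrib_right enn_exp_neg_add)
  have t_eq: "t f m j = (\<integral>\<^sup>+p. indicator {T j<..} (fst p) * ennreal (snd p) ^ m * e g p * e f p \<partial>R)"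
    if "\<And>u. 0 \<le> f u" for f m j
    unfolding t_def tail_moment_def e_def by (simp only: e_add[of f, OF that] mult.assoc)
  have c_eq: "c m j = (\<integral>\<^sup>+p. indicator {T j<..} (fst p) * ennreal (snd p) ^ m * e g p \<partial>R)" for m j
    unfolding c_def tail_moment_def e_def ..
  have t_le_c: "t f m j \<le> c m j" if "\<And>u. 0 \<le> f u" for f m j
    unfolding t_eq[OF that] c_eq
    by (intro nn_integral_mono mult_left_le) (auto simp: e_def enn_exp_neg_le_1)
  have zg: "ennreal z ^ m * e g (u, z) = ennreal (z ^ m * exp (- g u * z))" if "0 < z" for u z m
    using that g_nn by (simp add: e_def e_pos ennreal_power ennreal_mult del: minus_mult_left[symmetric])
  have kappa_int: "(\<integral>\<^sup>+ y. kappa g \<rho> m y * indicator {T j<..} y \<partial>\<eta>) = c m j" for m j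
    unfolding c_eq
  proof (rule R_eq[symmetric])
    fix u :: real assume u: "0 < u"
    note [measurable_cong] = rho_cong[OF u]
    show "kappa g \<rho> m u * indicator {T j<..} u = (\<integral>\<^sup>+z. ennreal (z ^ m * exp (- g u * z)) * indicator {T j<..} u \<partial>\<rho> u)"
      unfolding kappa_def by (rule nn_integral_multc[symmetric]) measurable
  next
    fix u z :: real assume "0 < z"
    then show "indicator {T j<..} (fst (u, z)) * ennreal (snd (u, z)) ^ m * e g (u, z)
      = ennreal (z ^ m * exp (- g u * z)) * indicator {T j<..} u"
      unfolding zg[OF \<open>0 < z\<close>, symmetric] by (simp only: fst_conv snd_conv mult_ac)
  qed measurable
  have phi_eq: "phi n T g \<rho> \<eta> S = path_weight c n S" for S
    unfolding phi_def path_weight_def kappa_int ..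
  define \<Phi> where "\<Phi> f = (\<Sum>S\<in>Spaths n. path_weight (t f) n S)" for f
  have Z_eq: "Zprob n T g \<rho> \<eta> S = path_weight c n S / (\<Sum>S'\<in>Spaths n. path_weight c n S')" for S
    unfolding Zprob_def phi_eq ..
  have T_mono: "T i \<le> T j" if "1 \<le> i" "i \<le> j" "j \<le> n" for i j
    using that(2,1,3)
  proof (induction j rule: dec_induct)
    case (step k)
    then have "T k < T (k + 1)" using T_incr by auto
    with step show ?case by auto
  qed simp
  define pr where "pr M = (\<Prod>i\<in>{1..n}. emeasure M {T i<..})" for M
  have [measurable]: "pr \<in> borel_measurable meas_space" unfolding pr_def by measurable
  have moment: "(\<integral>\<^sup>+M. pr M * enn_exp_neg (\<integral>\<^sup>+u. ennreal (g u + f u) \<partial>M) \<partial>L\<mu>)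
      = enn_exp_neg (psi g) * enn_exp_neg (\<Delta> f) * \<Phi> f"
    if [measurable]: "f \<in> borel_measurable borel" and nn: "\<And>u. 0 \<le> f u" for f
  proof -
    have "psi (\<lambda>u. g u + f u) = psi g + \<Delta> f"
      unfolding \<Delta>_def e_def by (rule psi_add) (use nn g_nn in auto)
    then have psi: "enn_exp_neg (psi (\<lambda>u. g u + f u)) = enn_exp_neg (psi g) * enn_exp_neg (\<Delta> f)"
      by (simp add: enn_exp_neg_add)
    show ?thesis
    \<comment> \<open>Without observed failures there is no first failure time to bound g from
      below, and the product is empty; the Laplace functional answers directly.\<close>
    proof (cases "n = 0")
      case True
      have "(\<integral>\<^sup>+M. enn_exp_neg (\<integral>\<^sup>+u. ennreal (g u + f u) \<partial>M) \<partial>L\<mu>) = enn_exp_neg (psi (\<lambda>u. g u + f u))"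
        unfolding psi_def by (rule laplace) (use nn g_nn in auto)
      moreover have "\<Phi> f = 1"
        unfolding \<Phi>_def using True path_sum_zero[of "t f" 0] by (simp add: path_sum_0)
      ultimately show ?thesis using True unfolding psi by (simp add: pr_def)
    next
      case False
      then have "0 < T 1" using T_pos nN by auto
      have "T 1 \<le> \<tau>" using T_mono[of 1 n] T_last False by auto
      have "(\<integral>\<^sup>+M. (\<Prod>i\<in>{1..n}. emeasure M {T i<..} + 0) * enn_exp_neg (\<integral>\<^sup>+u. ennreal (g u + f u) \<partial>M) \<partial>L\<mu>)
        = enn_exp_neg (psi (\<lambda>u. g u + f u)) * path_sum (tail_moment T (\<lambda>u. g u + f u)) n 0"
      proof (rule tail_product_moment[where e = "T 1"])
        fix u assume "T 1 < u"
        then have "T 1 \<le> g u"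
          unfolding g_def using \<open>0 < T 1\<close> \<open>T 1 \<le> \<tau>\<close> False nN by (intro gN_ge) auto
        with nn show "T 1 \<le> g u + f u" by (simp add: add_increasing2)
      qed (use nn g_nn T_mono \<open>0 < T 1\<close> in \<open>auto intro: add_nonneg_nonneg\<close>)
      moreover have "tail_moment T (\<lambda>u. g u + f u) = t f" by (intro ext) (simp add: t_def)
      ultimately show ?thesis unfolding psi by (simp add: pr_def \<Phi>_def path_sum_zero)
    qed
  qed
  define c0 where "c0 = ennreal (fact N / fact (N - n))"
  have c0: "c0 \<noteq> 0" "c0 \<noteq> \<top>" by (auto simp: c0_def)
  define lik where "lik = likelihood N n T \<tau>"
  have lik: "lik M = c0 * (pr M * enn_exp_neg (\<integral>\<^sup>+u. ennreal (g u) \<partial>M))" for M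
    by (simp add: lik_def likelihood_def c0_def pr_def g_def mult.assoc)
  have lik_meas[measurable]: "lik \<in> borel_measurable meas_space"
    unfolding lik[abs_def] by measurable
  define C where "C = (\<integral>\<^sup>+M. lik M \<partial>L\<mu>)"
  have t0: "t (\<lambda>_. 0) = c" by (intro ext) (simp add: t_def c_def)
  have \<Delta>0: "\<Delta> (\<lambda>_. 0) = 0" by (simp add: \<Delta>_def e_def)
  define a where "a = c0 * enn_exp_neg (psi g)"
  define D where "D = \<Phi> (\<lambda>_. 0)"
  have D_eq: "D = (\<Sum>S\<in>Spaths n. path_weight c n S)" by (simp add: D_def \<Phi>_def t0)
  \<comment> \<open>The case f = 0 of \<open>moment\<close> evaluates the marginal likelihood. As C
    is positive and finite, the prefactor a, hence also exp(-psi(g)), is nonzero, and the sum D over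
    the paths is positive and finite.\<close>
  have "C = a * D"
    using moment[of "\<lambda>_. 0"] by (simp add: C_def lik nn_integral_cmult \<Delta>0 a_def D_def mult.assoc)
  moreover have "0 < C" "C < \<top>" using post_def by (simp_all add: C_def lik_def)
  moreover have "a \<noteq> \<top>" by (simp add: a_def c0 ennreal_mult_eq_top_iff)
  ultimately have a: "a \<noteq> 0" "a \<noteq> \<top>" and D: "D \<noteq> 0" "D \<noteq> \<top>"
    by (auto simp: ennreal_mult_less_top)
  have post: "posterior L\<mu> lik = density L\<mu> (\<lambda>M. lik M / C)"
    by (simp add: posterior_def C_def)
  have post_laplace: "(\<integral>\<^sup>+M. enn_exp_neg (\<integral>\<^sup>+u. ennreal (f u) \<partial>M) \<partial>posterior L\<mu> lik)
      = enn_exp_neg (\<Delta> f) * \<Phi> f / D"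
    if [measurable]: "f \<in> borel_measurable borel" and nn: "\<And>u. 0 \<le> f u" for f
  proof -
    have "(\<integral>\<^sup>+M. enn_exp_neg (\<integral>\<^sup>+u. ennreal (f u) \<partial>M) \<partial>posterior L\<mu> lik)
      = (\<integral>\<^sup>+M. lik M / C * enn_exp_neg (\<integral>\<^sup>+u. ennreal (f u) \<partial>M) \<partial>L\<mu>)"
      unfolding post by (rule nn_integral_density) measurable
    also have "\<dots> = (\<integral>\<^sup>+M. c0 / C * (pr M * enn_exp_neg (\<integral>\<^sup>+u. ennreal (g u + f u) \<partial>M)) \<partial>L\<mu>)"
    proof (rule nn_integral_cong)
      fix M assume "M \<in> space L\<mu>"
      then have [measurable_cong]: "sets M = sets borel" by (simp add: space_L)
      have "(\<integral>\<^sup>+u. ennreal (g u + f u) \<partial>M) = (\<integral>\<^sup>+u. ennreal (g u) \<partial>M) + (\<integral>\<^sup>+u. ennreal (f u) \<partial>M)"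
        using nn g_nn by (subst nn_integral_add[symmetric]) (simp_all add: ennreal_plus)
      then show "lik M / C * enn_exp_neg (\<integral>\<^sup>+u. ennreal (f u) \<partial>M)
        = c0 / C * (pr M * enn_exp_neg (\<integral>\<^sup>+u. ennreal (g u + f u) \<partial>M))"
        by (simp add: lik enn_exp_neg_add divide_ennreal_def mult_ac)
    qed
    also have "\<dots> = c0 / C * (enn_exp_neg (psi g) * enn_exp_neg (\<Delta> f) * \<Phi> f)"
      using nn by (subst nn_integral_cmult) (auto simp: moment)
    also have "\<dots> = (a * (enn_exp_neg (\<Delta> f) * \<Phi> f)) / (a * D)"
      unfolding \<open>C = a * D\<close> by (simp add: a_def divide_ennreal_def mult_ac)
    also have "\<dots> = enn_exp_neg (\<Delta> f) * \<Phi> f / D"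
      using a D by (intro ennreal_mult_divide_cancel_left)
    finally show ?thesis .
  qed
  interpret P: prob_space P by (rule P)
  note [measurable] = Mstar_meas
  have YQ[measurable]: "(\<lambda>\<omega>. (Y \<omega> j, Q \<omega> j)) \<in> measurable P (borel \<Otimes>\<^sub>M borel)" for j
    using YQ_meas by (simp add: borel_prod)
  have [measurable]: "(\<lambda>\<omega>. Y \<omega> j) \<in> borel_measurable P" "(\<lambda>\<omega>. Q \<omega> j) \<in> borel_measurable P" for j
    using measurable_compose[OF YQ measurable_fst, of j] measurable_compose[OF YQ measurable_snd, of j] by simp_all
  have Sv_pred[measurable]: "Measurable.pred P (\<lambda>\<omega>. p (Sv \<omega>))" for p
    by (rule measurable_compose[OF Sv_meas]) simp
  define X where "X \<omega> = add_atoms (Mstar \<omega>) (jumps n (Sv \<omega>)) (Y \<omega>) (Q \<omega>)" for \<omega>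
  have Mstar_sets: "sets (Mstar \<omega>) = sets borel" if "\<omega> \<in> space P" for \<omega>
    using measurable_space[OF Mstar_meas that] by (simp add: space_meas_space)
  have X_meas[measurable]: "X \<in> measurable P meas_space"
  proof (rule measurable_meas_spaceI)
    fix B :: "real set" assume B[measurable]: "B \<in> sets borel"
    \<comment> \<open>The random set of jump indices is rewritten as a condition inside a sum over a
      fixed index set, which makes measurability visible.\<close>
    have "emeasure (X \<omega>) B = emeasure (Mstar \<omega>) B
      + (\<Sum>j\<in>{1..n}. if j \<in> jumps n (Sv \<omega>) then ennreal (Q \<omega> j) * indicator B (Y \<omega> j) else 0)"
      if "\<omega> \<in> space P" for \<omega>
    proof -
      have "{1..n} \<inter> jumps n (Sv \<omega>) = jumps n (Sv \<omega>)" by (auto simp: jumps_def)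
      then show ?thesis
        unfolding X_def by (simp add: emeasure_add_atoms Mstar_sets[OF that] B sum.If_cases)
    qed
    then show "(\<lambda>\<omega>. emeasure (X \<omega>) B) \<in> borel_measurable P"
      by (subst measurable_cong) (assumption, measurable)
  qed (simp add: X_def)
  \<comment> \<open>The two-stage draw of location and size is one draw from a density with respect
    to R: the normalisation of the second stage cancels the kappa in the first.\<close>
  have pair_law_eq: "pair_law n T g \<rho> \<eta> S j A
      = emeasure (density R (\<lambda>p. indicator {T j<..} (fst p) * ennreal (snd p) ^ incr S j * e g p / c (incr S j) j)) A"
    if j: "j \<in> jumps n S" "c (incr S j) j \<noteq> 0" "c (incr S j) j \<noteq> \<top>" and S: "S \<in> Spaths n"
      and A[measurable]: "A \<in> sets (borel \<Otimes>\<^sub>M borel)" for S j A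
  proof -
    define m where "m = incr S j"
    have m: "m \<in> {1..n}"
    proof -
      have "S j \<le> j" "j \<le> n" using S j by (auto simp: Spaths_eq partial_paths_def jumps_def)
      then show ?thesis using j(1) by (auto simp: m_def jumps_def incr_def)
    qed
    have reorder: "(i * k / c') * x = i / c' * (k * x)" for i k c' x :: ennreal
      by (simp add: divide_ennreal_def mult_ac)
    have "emeasure (density R (\<lambda>p. indicator {T j<..} (fst p) * ennreal (snd p) ^ m * e g p / c m j)) A
      = (\<integral>\<^sup>+p. indicator {T j<..} (fst p) * ennreal (snd p) ^ m * e g p / c m j * indicator A p \<partial>R)"
      by (rule emeasure_density) measurable
    also have "\<dots> = (\<integral>\<^sup>+ y. (indicator {T j<..} y * kappa g \<rho> m y / c m j) *
            (\<integral>\<^sup>+ z. indicator A (y, z) * ennreal (z ^ m * exp (- g y * z)) / kappa g \<rho> m y \<partial>\<rho> y) \<partial>\<eta>)"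
    proof (rule R_eq)
      fix y :: real assume y: "0 < y"
      note [measurable_cong] = rho_cong[OF y]
      have fin: "kappa g \<rho> m y \<noteq> \<top>" using kappa_fin m y by (auto simp: g_def less_top)
      let ?I = "\<integral>\<^sup>+ z. indicator A (y, z) * ennreal (z ^ m * exp (- g y * z)) \<partial>\<rho> y"
      have "(\<integral>\<^sup>+ z. indicator A (y, z) * ennreal (z ^ m * exp (- g y * z)) / kappa g \<rho> m y \<partial>\<rho> y) = ?I / kappa g \<rho> m y"
        by (rule nn_integral_divide) measurable
      \<comment> \<open>At locations with vanishing kappa the conditional law of the size is a
        quotient 0/0; the numerator vanishes there too, so the cancellation remains valid.\<close>
      moreover have "?I = 0" if "kappa g \<rho> m y = 0"
      proof -
        have "?I \<le> kappa g \<rho> m y"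
          unfolding kappa_def by (intro nn_integral_mono) (auto simp: indicator_def)
        with that show ?thesis by simp
      qed
      then have "kappa g \<rho> m y * (?I / kappa g \<rho> m y) = ?I"
        using fin by (cases "kappa g \<rho> m y = 0")
          (simp_all add: ennreal_times_divide mult.commute[of "kappa g \<rho> m y"] mult_divide_eq_ennreal)
      ultimately have "(indicator {T j<..} y * kappa g \<rho> m y / c m j) *
            (\<integral>\<^sup>+ z. indicator A (y, z) * ennreal (z ^ m * exp (- g y * z)) / kappa g \<rho> m y \<partial>\<rho> y)
          = indicator {T j<..} y / c m j * ?I"
        by (simp only: reorder)
      also have "\<dots> = (\<integral>\<^sup>+ z. indicator {T j<..} y / c m j * (indicator A (y, z) * ennreal (z ^ m * exp (- g y * z))) \<partial>\<rho> y)"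
        by (rule nn_integral_cmult[symmetric]) measurable
      finally show "(indicator {T j<..} y * kappa g \<rho> m y / c m j) *
            (\<integral>\<^sup>+ z. indicator A (y, z) * ennreal (z ^ m * exp (- g y * z)) / kappa g \<rho> m y \<partial>\<rho> y)
          = (\<integral>\<^sup>+ z. indicator {T j<..} y / c m j * (indicator A (y, z) * ennreal (z ^ m * exp (- g y * z))) \<partial>\<rho> y)" .
    next
      fix u z :: real assume "0 < z"
      then show "indicator {T j<..} (fst (u, z)) * ennreal (snd (u, z)) ^ m * e g (u, z) / c m j * indicator A (u, z)
        = indicator {T j<..} u / c m j * (indicator A (u, z) * ennreal (z ^ m * exp (- g u * z)))"
        unfolding zg[symmetric, OF \<open>0 < z\<close>] by (simp add: divide_ennreal_def mult_ac)
    qed measurable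
    also have "\<dots> = pair_law n T g \<rho> \<eta> S j A"
      unfolding pair_law_def Let_def m_def[symmetric] kappa_int[symmetric]
      by (simp add: mult.commute[of "indicator {T j<..} _"])
    finally show ?thesis by (simp add: m_def)
  qed
  have step: "(\<integral>\<^sup>+\<omega>. indicator {\<omega> \<in> space P. Sv \<omega> = S} \<omega> * (\<Prod>j\<in>jumps n S. e f (Y \<omega> j, Q \<omega> j))
        * enn_exp_neg (\<integral>\<^sup>+u. ennreal (f u) \<partial>Mstar \<omega>) \<partial>P)
      = path_weight (t f) n S / D * enn_exp_neg (\<Delta> f)"
    if S: "S \<in> Spaths n" and [measurable]: "f \<in> borel_measurable borel" and nn: "\<And>u. 0 \<le> f u" for S f
  proof (cases "path_weight c n S = 0")
    \<comment> \<open>A path of weight 0 may have undefined pair laws, but it is drawn with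
      probability 0, and its weight under f, being dominated by that at f = 0, vanishes as
      well.\<close>
    case True
    have "path_weight (t f) n S \<le> path_weight c n S"
      unfolding path_weight_def by (intro prod_mono_ennreal mult_left_mono t_le_c nn) auto
    with True have "path_weight (t f) n S = 0" by simp
    moreover have "emeasure P {\<omega> \<in> space P. Sv \<omega> = S} = 0"
    proof -
      have "{\<omega> \<in> space P. Sv \<omega> = S} = {\<omega> \<in> space P. Sv \<omega> = S \<and> (\<forall>j\<in>jumps n S. (Y \<omega> j, Q \<omega> j) \<in> space (borel \<Otimes>\<^sub>M borel))
          \<and> Mstar \<omega> \<in> space meas_space}"
        using measurable_space[OF Mstar_meas] by (auto simp: space_pair_measure)
      then show ?thesis
        using three_step[rule_format, OF S, of "\<lambda>_. space (borel \<Otimes>\<^sub>M borel)" "space meas_space"] True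
        by (simp add: Z_eq[unfolded g_def] sets.top)
    qed
    then have "AE \<omega> in P. \<not> (\<omega> \<in> {\<omega> \<in> space P. Sv \<omega> = S})"
      by (intro AE_not_in null_setsI) auto
    then have "(\<integral>\<^sup>+\<omega>. indicator {\<omega> \<in> space P. Sv \<omega> = S} \<omega> * (\<Prod>j\<in>jumps n S. e f (Y \<omega> j, Q \<omega> j))
        * enn_exp_neg (\<integral>\<^sup>+u. ennreal (f u) \<partial>Mstar \<omega>) \<partial>P) = (\<integral>\<^sup>+\<omega>. 0 \<partial>P)"
      by (intro nn_integral_cong_AE) (auto elim!: eventually_mono)
    ultimately show ?thesis by simp
  next
    case False
    let ?b = "\<lambda>j. of_nat ((j - 1 - S (j - 1)) choose (j - S j)) :: ennreal"
    let ?c = "\<lambda>j. c (incr S j) j"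
    have "path_weight c n S \<le> D"
      unfolding D_eq using S by (intro member_le_sum) auto
    \<comment> \<open>Nonzero and finite as a product, the weight has only nonzero and finite
      factors, so every normalising constant of the pair laws is usable.\<close>
    then have "path_weight c n S \<noteq> \<top>" using D by (auto simp: top_unique)
    then have cj: "?c j \<noteq> 0" "?c j \<noteq> \<top>" if "j \<in> jumps n S" for j
      using False that by (auto simp: path_weight_def ennreal_prod_eq_top ennreal_mult_eq_top_iff)
    define \<nu> where "\<nu> j = density R (\<lambda>p. indicator {T j<..} (fst p) * ennreal (snd p) ^ incr S j * e g p / ?c j)" for j
    have "(\<integral>\<^sup>+\<omega>. indicator {\<omega> \<in> space P. Sv \<omega> = S} \<omega> * (\<Prod>j\<in>jumps n S. e f (Y \<omega> j, Q \<omega> j))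
        * enn_exp_neg (\<integral>\<^sup>+u. ennreal (f u) \<partial>Mstar \<omega>) \<partial>P)
      = Zprob n T g \<rho> \<eta> S * (\<Prod>j\<in>jumps n S. \<integral>\<^sup>+p. e f p \<partial>\<nu> j) * (\<integral>\<^sup>+M. enn_exp_neg (\<integral>\<^sup>+u. ennreal (f u) \<partial>M) \<partial>Lstar)"
    proof (rule nn_integral_prod_rectangles'[where N = "\<lambda>_. borel \<Otimes>\<^sub>M borel" and K' = meas_space])
      fix A :: "nat \<Rightarrow> (real \<times> real) set" and B
      assume A: "\<And>j. j \<in> jumps n S \<Longrightarrow> A j \<in> sets (borel \<Otimes>\<^sub>M borel)" and B: "B \<in> sets meas_space"
      have "emeasure P {\<omega> \<in> space P. Sv \<omega> = S \<and> (\<forall>j\<in>jumps n S. (Y \<omega> j, Q \<omega> j) \<in> A j) \<and> Mstar \<omega> \<in> B}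
        = Zprob n T g \<rho> \<eta> S * (\<Prod>j\<in>jumps n S. pair_law n T g \<rho> \<eta> S j (A j)) * emeasure Lstar B"
        unfolding g_def using A B by (intro three_step[rule_format, OF S]) auto
      also have "(\<Prod>j\<in>jumps n S. pair_law n T g \<rho> \<eta> S j (A j)) = (\<Prod>j\<in>jumps n S. emeasure (\<nu> j) (A j))"
        unfolding \<nu>_def using cj S A by (intro prod.cong refl pair_law_eq)
      also have "{\<omega> \<in> space P. Sv \<omega> = S \<and> (\<forall>j\<in>jumps n S. (Y \<omega> j, Q \<omega> j) \<in> A j) \<and> Mstar \<omega> \<in> B}
        = {\<omega> \<in> space P. \<omega> \<in> {\<omega> \<in> space P. Sv \<omega> = S} \<and> (\<forall>j\<in>jumps n S. (Y \<omega> j, Q \<omega> j) \<in> A j) \<and> Mstar \<omega> \<in> B}"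
        by auto
      finally show "emeasure P {\<omega> \<in> space P. \<omega> \<in> {\<omega> \<in> space P. Sv \<omega> = S} \<and> (\<forall>j\<in>jumps n S. (Y \<omega> j, Q \<omega> j) \<in> A j) \<and> Mstar \<omega> \<in> B}
        = Zprob n T g \<rho> \<eta> S * (\<Prod>j\<in>jumps n S. emeasure (\<nu> j) (A j)) * emeasure Lstar B" .
    qed (auto simp: \<nu>_def sets_R sets_Lstar)
    also have "(\<Prod>j\<in>jumps n S. \<integral>\<^sup>+p. e f p \<partial>\<nu> j) = (\<Prod>j\<in>jumps n S. t f (incr S j) j / ?c j)"
    proof (intro prod.cong refl)
      fix j
      have "(\<integral>\<^sup>+p. e f p \<partial>\<nu> j)
        = (\<integral>\<^sup>+p. indicator {T j<..} (fst p) * ennreal (snd p) ^ incr S j * e g p / ?c j * e f p \<partial>R)"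
        unfolding \<nu>_def by (rule nn_integral_density) measurable
      also have "\<dots> = (\<integral>\<^sup>+p. indicator {T j<..} (fst p) * ennreal (snd p) ^ incr S j * e g p * e f p / ?c j \<partial>R)"
        by (simp add: divide_ennreal_def mult_ac)
      also have "\<dots> = t f (incr S j) j / ?c j"
        unfolding t_eq[OF nn] by (rule nn_integral_divide) measurable
      finally show "(\<integral>\<^sup>+p. e f p \<partial>\<nu> j) = t f (incr S j) j / ?c j" .
    qed
    \<comment> \<open>The numerator of the path probability contains each constant c once; the
      ratios t/c exchange it for t and keep the binomial coefficient.\<close>
    also have "Zprob n T g \<rho> \<eta> S * (\<Prod>j\<in>jumps n S. t f (incr S j) j / ?c j) = path_weight (t f) n S / D"
    proof -
      have "path_weight c n S * (\<Prod>j\<in>jumps n S. t f (incr S j) j / ?c j) = path_weight (t f) n S"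
        unfolding path_weight_def prod.distrib[symmetric]
      proof (intro prod.cong refl)
        fix j assume j: "j \<in> jumps n S"
        have "?c j * (t f (incr S j) j / ?c j) = t f (incr S j) j"
          using cj[OF j] by (simp add: ennreal_times_divide mult.commute[of "?c j"] mult_divide_eq_ennreal)
        then show "?b j * ?c j * (t f (incr S j) j / ?c j) = ?b j * t f (incr S j) j"
          by (simp add: mult.assoc)
      qed
      then show ?thesis
        unfolding Z_eq D_eq[symmetric] by (metis divide_ennreal_def mult.assoc mult.commute)
    qed
    finally show ?thesis using Lstar_laplace nn by simp
  qed
  \<comment> \<open>The experiment is described only on S-paths. The contributions at f = 0 sum to D
    / D = 1, so that no probability is left for other functions.\<close>
  have AE_Sv: "AE \<omega> in P. Sv \<omega> \<in> Spaths n"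
  proof -
    have "emeasure P {\<omega> \<in> space P. Sv \<omega> \<in> Spaths n} = (\<integral>\<^sup>+\<omega>. indicator {\<omega> \<in> space P. Sv \<omega> \<in> Spaths n} \<omega> \<partial>P)"
      by (rule nn_integral_indicator[symmetric]) measurable
    also have "\<dots> = (\<integral>\<^sup>+\<omega>. (\<Sum>S\<in>Spaths n. indicator {\<omega> \<in> space P. Sv \<omega> = S} \<omega>) \<partial>P)"
      by (intro nn_integral_cong) (auto simp: indicator_def sum.delta)
    also have "\<dots> = (\<Sum>S\<in>Spaths n. \<integral>\<^sup>+\<omega>. indicator {\<omega> \<in> space P. Sv \<omega> = S} \<omega> \<partial>P)"
      by (rule nn_integral_sum) measurable
    also have "\<dots> = (\<Sum>S\<in>Spaths n. path_weight c n S / D)"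
      using step[of _ "\<lambda>_. 0"] by (intro sum.cong refl) (simp add: e_def t0 \<Delta>0)
    also have "\<dots> = 1"
      using D unfolding divide_ennreal_def sum_distrib_right[symmetric] D_eq[symmetric]
      by (simp add: ennreal_divide_self less_top flip: divide_ennreal_def)
    finally have "emeasure P {\<omega> \<in> space P. Sv \<omega> \<in> Spaths n} = 1" .
    then have "P.prob {\<omega> \<in> space P. Sv \<omega> \<in> Spaths n} = 1"
      by (simp add: measure_def)
    from P.AE_prob_1[OF this] show ?thesis by (auto elim: eventually_mono)
  qed
  have "distr P meas_space X = posterior L\<mu> lik"
  proof (rule Laplace_functional_unique)
    show "finite_measure (distr P meas_space X)"
      by (rule P.finite_measure_distr) measurable
    show "finite_measure (posterior L\<mu> lik)"
    proof (rule finite_measureI)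
      have "emeasure (posterior L\<mu> lik) (space (posterior L\<mu> lik)) = (\<integral>\<^sup>+M. lik M / C \<partial>L\<mu>)"
        unfolding post by (simp add: emeasure_density cong: nn_integral_cong)
      also have "\<dots> = C / C"
        unfolding C_def by (rule nn_integral_divide) measurable
      also have "\<dots> \<le> 1" by (rule ennreal_divide_self_le_1)
      finally show "emeasure (posterior L\<mu> lik) (space (posterior L\<mu> lik)) \<noteq> \<infinity>"
        by (auto simp: top_unique)
    qed
    show "sets (distr P meas_space X) = sets meas_space" "sets (posterior L\<mu> lik) = sets meas_space"
      by (simp_all add: post sets_L)
    fix f :: "real \<Rightarrow> real" assume f[measurable]: "f \<in> borel_measurable borel" and nn: "\<And>u. 0 \<le> f u"
    let ?G = "\<lambda>S \<omega>. indicator {\<omega> \<in> space P. Sv \<omega> = S} \<omega> * (\<Prod>j\<in>jumps n S. e f (Y \<omega> j, Q \<omega> j))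
        * enn_exp_neg (\<integral>\<^sup>+u. ennreal (f u) \<partial>Mstar \<omega>)"
    have "(\<integral>\<^sup>+M. enn_exp_neg (\<integral>\<^sup>+u. ennreal (f u) \<partial>M) \<partial>distr P meas_space X)
      = (\<integral>\<^sup>+\<omega>. enn_exp_neg (\<integral>\<^sup>+u. ennreal (f u) \<partial>X \<omega>) \<partial>P)"
      by (rule nn_integral_distr) measurable
    also have "\<dots> = (\<integral>\<^sup>+\<omega>. (\<Sum>S\<in>Spaths n. ?G S \<omega>) \<partial>P)"
    proof (rule nn_integral_cong_AE, use AE_Sv AE_space in eventually_elim)
      fix \<omega> assume S: "Sv \<omega> \<in> Spaths n" and \<omega>: "\<omega> \<in> space P"
      \<comment> \<open>Exactly one summand is nonzero, that of the path drawn; it splits the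
        exponential over the atoms and the independent random measure.\<close>
      have "(\<Sum>S\<in>Spaths n. ?G S \<omega>) = (\<Sum>S\<in>Spaths n. if S = Sv \<omega> then ?G S \<omega> else 0)"
        by (intro sum.cong) (auto simp: indicator_def)
      also have "\<dots> = ?G (Sv \<omega>) \<omega>" using S by simp
      also have "\<dots> = enn_exp_neg (\<integral>\<^sup>+u. ennreal (f u) \<partial>X \<omega>)"
        unfolding X_def using \<omega> by (subst nn_integral_add_atoms)
          (simp_all add: Mstar_sets enn_exp_neg_add enn_exp_neg_sum e_def mult.commute)
      finally show "enn_exp_neg (\<integral>\<^sup>+u. ennreal (f u) \<partial>X \<omega>) = (\<Sum>S\<in>Spaths n. ?G S \<omega>)" ..
    qed
    also have "\<dots> = (\<Sum>S\<in>Spaths n. \<integral>\<^sup>+\<omega>. ?G S \<omega> \<partial>P)"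
      by (rule nn_integral_sum) measurable
    also have "\<dots> = (\<Sum>S\<in>Spaths n. path_weight (t f) n S / D * enn_exp_neg (\<Delta> f))"
      by (intro sum.cong refl step f nn)
    also have "\<dots> = enn_exp_neg (\<Delta> f) * \<Phi> f / D"
      unfolding \<Phi>_def divide_ennreal_def sum_distrib_left sum_distrib_right by (simp add: mult_ac)
    also have "\<dots> = (\<integral>\<^sup>+M. enn_exp_neg (\<integral>\<^sup>+u. ennreal (f u) \<partial>M) \<partial>posterior L\<mu> lik)"
      by (rule post_laplace[symmetric, OF f nn])
    finally show "(\<integral>\<^sup>+M. enn_exp_neg (\<integral>\<^sup>+u. ennreal (f u) \<partial>M) \<partial>distr P meas_space X)
      = (\<integral>\<^sup>+M. enn_exp_neg (\<integral>\<^sup>+u. ennreal (f u) \<partial>M) \<partial>posterior L\<mu> lik)" .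
  qed
  then show ?thesis by (simp add: X_def[abs_def] lik_def)
qed

end
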